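(* Let a non-degenerate real random variable have a characteristic function $f(t)$ that is analytic in the disk $|t|<r$ for some $r>0$, and let $g(t)=\log f(t)$. Assume that the set $\mathfrak{K}=\{\varkappa_k/k! : k=0,1,2,\ldots\}$ is finite. Then either $$g(t)=-\sigma^2t^2+iat\qquad\text{for some } \sigma\ge 0,\ a\in\mathbb{R},$$ or $$g(t)=\frac{P(t)}{1+ it}\quad\text{or}\quad g(t)=\frac{P(t)}{1- it},\qquad\text{where } P \text{ is a polynomial},$$ or $$g(t)=\frac{P(t)}{1+t^2},\qquad\text{where } P \text{ is a polynomial}.$$
   Context: For a real random variable $X$, its characteristic function is $f(t)=\mathbb{E}[e^{itX}]$, $t\in\mathbb{R}$. Saying that $f$ is analytic in the disk $|t|<r$ means that $f$ coincides on the real interval $(-r,r)$ with a function analytic in the complex disk $|t|<r$. The function $g=\log f$ is the branch of the logarithm near $t=0$ with $g(0)=0$ (and its analytic continuation), and the cumulants $\varkappa_k$ are defined by its power series expansion at zero, $g(t)=\sum_{k=0}^{\infty}i^k\frac{\varkappa_k}{k!}t^k$. The set $\mathfrak{K}$ is the set of different values of the fractions $\varkappa_k/k!$, $k=0,1,2,\ldots$. Polynomials have complex coefficients. A random variable is degenerate if it is almost surely constant, and non-degenerate otherwise. *)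

theory Defs
  imports "HOL-Probability.Probability" "HOL-Complex_Analysis.Complex_Analysis"
begin

definition analytic_in_disk :: "(real \<Rightarrow> complex) \<Rightarrow> real \<Rightarrow> bool" where
  "analytic_in_disk \<phi> r \<longleftrightarrow>
     (\<exists>F. F analytic_on ball 0 r \<and> (\<forall>t::real. \<bar>t\<bar> < r \<longrightarrow> F (of_real t) = \<phi> t))"

text \<open>The function \<open>g\<close> is, on the domain \<open>D\<close>, the analytic continuation of the branch of
  \<open>log \<phi>\<close> near the origin that vanishes at the origin. The identity \<open>exp g = \<phi>\<close> is only required
  for real arguments near 0; as \<open>D\<close> is connected, this determines \<open>g\<close> on all of \<open>D\<close>.\<close>

definition is_log_of :: "(complex \<Rightarrow> complex) \<Rightarrow> (real \<Rightarrow> complex) \<Rightarrow> complex set \<Rightarrow> bool" where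
  "is_log_of g \<phi> D \<longleftrightarrow>
     open D \<and> connected D \<and> 0 \<in> D \<and> g analytic_on D \<and> g 0 = 0 \<and>
     (\<forall>\<^sub>F t::real in nhds 0. exp (g (of_real t)) = \<phi> t)"

text \<open>The coefficient of \<open>t ^ k\<close> in the power series of \<open>g\<close> at 0 is \<open>\<i> ^ k * cumulant g k / fact k\<close>;
  see \<open>sums_cumulant\<close> below. For the logarithm of a characteristic function the cumulants are
  real numbers, but they are typed as complex numbers here.\<close>

definition cumulant :: "(complex \<Rightarrow> complex) \<Rightarrow> nat \<Rightarrow> complex" where
  "cumulant g k = fact k * fps_nth (fps_expansion g 0) k / \<i> ^ k"

lemma sums_cumulant:
  assumes "g analytic_on {0}"
  shows "\<forall>\<^sub>F t in nhds 0. (\<lambda>k. \<i> ^ k * (cumulant g k / fact k) * t ^ k) sums g t"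
proof -
  obtain e where e: "e > 0" "g holomorphic_on ball 0 e"
    using assms by (auto simp: analytic_on_def)
  have "(\<lambda>k. \<i> ^ k * (cumulant g k / fact k) * t ^ k) sums g t" if "t \<in> ball 0 e" for t
    using holomorphic_power_series[OF e(2) that]
    by (simp add: cumulant_def fps_expansion_def)
  then show ?thesis
    using eventually_nhds_in_open[of "ball (0::complex) e" 0] e(1)
    by (auto elim: eventually_mono)
qed

lemma ex_is_log_of:
  assumes "analytic_in_disk \<phi> r" "r > 0" "\<phi> 0 = 1"
  shows "\<exists>g \<delta>. \<delta> > 0 \<and> is_log_of g \<phi> (ball 0 \<delta>)"
proof -
  obtain F where F: "F analytic_on ball 0 r" "\<And>t::real. \<bar>t\<bar> < r \<Longrightarrow> F (of_real t) = \<phi> t"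
    using assms(1) by (auto simp: analytic_in_disk_def)
  have F0: "F 0 = 1"
    using F(2)[of 0] assms by simp
  have "isCont F 0"
    using F(1) assms(2) analytic_on_subset[of F "ball 0 r" "{0}"]
    by (intro analytic_at_imp_isCont) auto
  then obtain d where d: "d > 0" "\<And>z. dist z 0 < d \<Longrightarrow> dist (F z) 1 < 1"
    unfolding continuous_at_eps_delta F0 by (metis zero_less_one)
  define \<delta> where "\<delta> = min d r"
  have \<delta>: "\<delta> > 0" "\<delta> \<le> d" "\<delta> \<le> r"
    using d(1) assms(2) by (auto simp: \<delta>_def)
  have nonpos: "F z \<notin> \<real>\<^sub>\<le>\<^sub>0" if "z \<in> ball 0 \<delta>" for z
  proof
    assume "F z \<in> \<real>\<^sub>\<le>\<^sub>0"
    then obtain x where x: "F z = of_real x" "x \<le> 0"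
      by (auto elim: nonpos_Reals_cases)
    have "dist (F z) 1 = \<bar>x - 1\<bar>"
      unfolding x(1) dist_norm by (metis norm_of_real of_real_1 of_real_diff)
    then show False
      using d(2)[of z] that \<delta>(2) x(2) by (auto simp: dist_commute)
  qed
  have "F analytic_on ball 0 \<delta>"
    using F(1) \<delta>(3) by (meson analytic_on_subset subset_ball)
  then have "(\<lambda>z. Ln (F z)) analytic_on ball 0 \<delta>"
    using nonpos by (intro analytic_intros) auto
  moreover have "\<forall>\<^sub>F t::real in nhds 0. exp (Ln (F (of_real t))) = \<phi> t"
    using eventually_nhds_in_open[of "ball (0::real) \<delta>" 0] \<delta>
  proof (auto elim!: eventually_mono)
    fix t :: real
    assume t: "\<bar>t\<bar> < \<delta>"
    then have "F (of_real t) \<noteq> 0"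
      using nonpos[of "of_real t"] by auto
    then show "exp (Ln (F (of_real t))) = \<phi> t"
      using F(2)[of t] t \<delta>(3) by simp
  qed
  ultimately have "is_log_of (\<lambda>z. Ln (F z)) \<phi> (ball 0 \<delta>)"
    using \<delta>(1) F0 by (simp add: is_log_of_def)
  then show ?thesis
    using \<delta>(1) by blast
qed

end

theory Submission
  imports Defs "HOL-Computational_Algebra.Fundamental_Theorem_Algebra"
begin

text \<open>Put \<open>c k = cumulant g k / fact k\<close> and \<open>K s = (\<Sum>k. c k * s ^ k)\<close>, so that \<open>g t = K (\<i> * t)\<close> near
  the origin. As the coefficients take finitely many values they are bounded, and \<open>K\<close> is
  holomorphic in the unit disk. Three ideas give the theorem.

  First, probability makes \<open>exp \<circ> K\<close> holomorphic in more than the disk. A characteristic function that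
  agrees near 0 with a function holomorphic in the unit disk belongs to a law whose even moments
  are the Taylor coefficients up to sign, so \<open>exp (y * \<bar>X\<bar>)\<close> is integrable for \<open>y < 1\<close>
  (\<open>integrable_exp_abs_if_char_analytic\<close>). Hence \<open>exp (K s)\<close> is the moment generating function
  \<open>\<Phi> s = E (exp (s * X))\<close>, which is holomorphic in the whole strip \<open>\<bar>Re s\<bar> < 1\<close>
  (\<open>holomorphic_moment_generating_function\<close>). The strip contains the unit circle except
  for the points 1 and -1.

  Second, \<open>\<Phi>\<close> has a point \<open>\<zeta>\<close> on the circle where it does not vanish, and there \<open>K\<close>, a logarithm of
  \<open>\<Phi>\<close>, continues across the circle. By a theorem of Szego, a power series with finitely many different
  coefficients that continues across an arc of the unit circle has eventually periodic
  coefficients (\<open>Szego_finite_coefficients\<close>). Thus \<open>K\<close> is a rational function whose poles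
  are simple and are roots of unity.

  Third, \<open>K\<close> has no poles on the circle except possibly 1 and -1: a function \<open>\<Phi>\<close> holomorphic at \<open>\<omega>\<close> has a
  logarithmic derivative with at most a simple pole there, whereas a pole of \<open>K\<close> at \<open>\<omega>\<close> would give
  \<open>deriv K\<close> a double pole (\<open>double_pole_of_log_derivative_cancels\<close>). So \<open>(1 - s\<^sup>2) * K s\<close> is a
  polynomial. Substituting \<open>s = \<i> * t\<close> and continuing analytically from the origin to the domain of
  \<open>g\<close>, one obtains \<open>g t = P t / (1 + t\<^sup>2)\<close>. This is the last of the alternatives in the theorem; the
  others are special cases of it, in which numerator and denominator have a common factor.\<close>

section \<open>Exponential moments from an analytic characteristic function\<close>

text \<open>The alternating sign is chosen so that the remainder is nonnegative for positive \<open>n\<close>; this makes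
  Fatou's lemma applicable to it.\<close>

definition cos_remainder :: "nat \<Rightarrow> real \<Rightarrow> real" where
  "cos_remainder n x = (-1) ^ n * (cos x - (\<Sum>j<n. (-1) ^ j * x ^ (2 * j) / fact (2 * j)))"

lemma cos_remainder_Suc: "cos_remainder (Suc n) x = x ^ (2 * n) / fact (2 * n) - cos_remainder n x"
proof -
  have "(-1) ^ n * ((-1) ^ n * x ^ (2 * n) / fact (2 * n)) = x ^ (2 * n) / fact (2 * n)"
    by (simp flip: power_add mult_2)
  then show ?thesis
    by (simp add: cos_remainder_def algebra_simps)
qed

text \<open>Lagrange's form of the Taylor remainder after \<open>2 * n\<close> terms.\<close>

lemma abs_cos_remainder_le: "\<bar>cos_remainder n x\<bar> \<le> x ^ (2 * n) / fact (2 * n)"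
proof -
  have sum: "(\<Sum>m<2 * n. cos_coeff m * x ^ m) = (\<Sum>j<n. (-1) ^ j * x ^ (2 * j) / fact (2 * j))"
    by (induction n) (simp_all add: cos_coeff_def)
  obtain t where "cos x = (\<Sum>m<2 * n. cos_coeff m * x ^ m)
      + cos (t + 1 / 2 * real (2 * n) * pi) / fact (2 * n) * x ^ (2 * n)"
    using Maclaurin_cos_expansion by blast
  then have "\<bar>cos_remainder n x\<bar> = \<bar>cos (t + 1 / 2 * real (2 * n) * pi)\<bar> * (x ^ (2 * n) / fact (2 * n))"
    unfolding cos_remainder_def sum by (simp add: abs_mult power_even_abs)
  also have "\<dots> \<le> 1 * (x ^ (2 * n) / fact (2 * n))"
    by (intro mult_right_mono) (auto simp: abs_cos_le_one)
  finally show ?thesis by simp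
qed

text \<open>The upper bound for the remainder of order \<open>n - 1\<close> is exactly the next Taylor term, and subtracting
  it changes the sign.\<close>

lemma cos_remainder_nonneg: "n > 0 \<Longrightarrow> cos_remainder n x \<ge> 0"
  using abs_le_D1[OF abs_cos_remainder_le[of "n - 1" x]] cos_remainder_Suc[of "n - 1" x] by auto

lemma cos_remainder_asymptotic:
  assumes "t \<longlonglongrightarrow> 0" and "\<And>m. t m \<noteq> 0"
  shows "(\<lambda>m. cos_remainder n (t m * x) / t m ^ (2 * n)) \<longlonglongrightarrow> x ^ (2 * n) / fact (2 * n)"
proof (rule Lim_transform2)
  have "(\<lambda>m. (t m)\<^sup>2 * (x ^ (2 * Suc n) / fact (2 * Suc n))) \<longlonglongrightarrow> 0\<^sup>2 * (x ^ (2 * Suc n) / fact (2 * Suc n))"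
    by (intro tendsto_intros assms(1))
  then have lim: "(\<lambda>m. (t m)\<^sup>2 * (x ^ (2 * Suc n) / fact (2 * Suc n))) \<longlonglongrightarrow> 0"
    by simp
  show "(\<lambda>m. x ^ (2 * n) / fact (2 * n) - cos_remainder n (t m * x) / t m ^ (2 * n)) \<longlonglongrightarrow> 0"
  proof (rule Lim_null_comparison[OF _ lim], intro always_eventually allI)
    fix m
    have "x ^ (2 * n) / fact (2 * n) - cos_remainder n (t m * x) / t m ^ (2 * n)
        = cos_remainder (Suc n) (t m * x) / t m ^ (2 * n)"
      unfolding cos_remainder_Suc using assms(2)[of m] by (simp add: field_simps power_mult_distrib)
    also have "norm \<dots> = \<bar>cos_remainder (Suc n) (t m * x)\<bar> / t m ^ (2 * n)"
      by (simp add: power_even_abs)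
    also have "\<dots> \<le> (t m * x) ^ (2 * Suc n) / fact (2 * Suc n) / t m ^ (2 * n)"
      by (intro divide_right_mono abs_cos_remainder_le) simp
    also have "\<dots> = (t m)\<^sup>2 * (x ^ (2 * Suc n) / fact (2 * Suc n))"
    proof -
      have "t m ^ (2 * Suc n) = (t m)\<^sup>2 * t m ^ (2 * n)"
        by (simp add: power2_eq_square)
      then show ?thesis
        using assms(2)[of m] by (simp add: power_mult_distrib del: mult_Suc_right power_Suc fact_Suc)
    qed
    finally show "norm (x ^ (2 * n) / fact (2 * n) - cos_remainder n (t m * x) / t m ^ (2 * n))
        \<le> (t m)\<^sup>2 * (x ^ (2 * Suc n) / fact (2 * Suc n))" .
  qed
qed (rule tendsto_const)

context real_distribution
begin

text \<open>Induction on \<open>n\<close>. Once the lower even moments are known to match the coefficients \<open>b\<close>, the expectation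
  of \<open>cos_remainder n (t * x)\<close> is the tail of the series for the real part of the characteristic
  function, so after division by \<open>t ^ (2 * n)\<close> it tends to the coefficient \<open>b n\<close> up to sign. The
  integrand is nonnegative and tends to \<open>x ^ (2 * n) / fact (2 * n)\<close>: Fatou's lemma gives
  integrability of the next moment, and then dominated convergence its value.\<close>

lemma even_moments_from_char_series:
  assumes \<rho>: "\<rho> > 0"
    and b: "\<And>t. \<bar>t\<bar> < \<rho> \<Longrightarrow> (\<lambda>k. b k * t ^ (2 * k)) sums expectation (\<lambda>x. cos (t * x))"
  shows "integrable M (\<lambda>x. x ^ (2 * n)) \<and> expectation (\<lambda>x. x ^ (2 * n)) / fact (2 * n) = (-1) ^ n * b n"
proof (induction n rule: less_induct)
  case (less n)
  have int_cos: "integrable M (\<lambda>x. cos (t * x))" for t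
    by (rule integrable_const_bound[where B = 1]) auto
  have int_rem: "integrable M (\<lambda>x. cos_remainder n (t * x))" for t
    unfolding cos_remainder_def using less.IH
    by (intro integrable_mult_right Bochner_Integration.integrable_diff int_cos Bochner_Integration.integrable_sum)
       (auto simp: power_mult_distrib)
  have E_rem: "expectation (\<lambda>x. cos_remainder n (t * x))
      = (-1) ^ n * (expectation (\<lambda>x. cos (t * x)) - (\<Sum>j<n. b j * t ^ (2 * j)))" for t
  proof -
    have int: "integrable M (\<lambda>x. (-1) ^ j * (t * x) ^ (2 * j) / fact (2 * j))" if "j < n" for j
      using less.IH[OF that] by (simp add: power_mult_distrib)
    have "expectation (\<lambda>x. \<Sum>j<n. (-1) ^ j * (t * x) ^ (2 * j) / fact (2 * j))
        = (\<Sum>j<n. expectation (\<lambda>x. (-1) ^ j * (t * x) ^ (2 * j) / fact (2 * j)))"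
      using int by (intro Bochner_Integration.integral_sum) auto
    also have "\<dots> = (\<Sum>j<n. b j * t ^ (2 * j))"
    proof (intro sum.cong refl)
      fix j assume "j \<in> {..<n}"
      then have "expectation (\<lambda>x. x ^ (2 * j)) / fact (2 * j) = (-1) ^ j * b j"
        using less.IH by auto
      moreover have "expectation (\<lambda>x. (-1) ^ j * (t * x) ^ (2 * j) / fact (2 * j))
          = (-1) ^ j * t ^ (2 * j) * (expectation (\<lambda>x. x ^ (2 * j)) / fact (2 * j))"
        by (simp add: power_mult_distrib)
      moreover have "(-1) ^ j * t ^ (2 * j) * ((-1) ^ j * b j) = b j * t ^ (2 * j)"
        by (simp add: mult.assoc mult.left_commute[of "b j"] flip: power_mult_distrib)
      ultimately show "expectation (\<lambda>x. (-1) ^ j * (t * x) ^ (2 * j) / fact (2 * j)) = b j * t ^ (2 * j)"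
        by simp
    qed
    finally have *: "expectation (\<lambda>x. \<Sum>j<n. (-1) ^ j * (t * x) ^ (2 * j) / fact (2 * j)) = (\<Sum>j<n. b j * t ^ (2 * j))" .
    have "expectation (\<lambda>x. cos_remainder n (t * x)) = (-1) ^ n * (expectation (\<lambda>x. cos (t * x))
        - expectation (\<lambda>x. \<Sum>j<n. (-1) ^ j * (t * x) ^ (2 * j) / fact (2 * j)))"
      unfolding cos_remainder_def using int int_cos
      by (subst Bochner_Integration.integral_diff[symmetric])
         (auto intro!: Bochner_Integration.integrable_sum)
    then show ?thesis unfolding * .
  qed
  \<comment> \<open>The offset 2 keeps every \<open>t m\<close> strictly inside the interval of convergence.\<close>
  define t where "t m = \<rho> / real (m + 2)" for m
  have t: "0 < t m" "\<bar>t m\<bar> < \<rho>" for m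
    using \<rho> by (auto simp: t_def field_simps intro!: add_pos_nonneg)
  have t_lim: "t \<longlonglongrightarrow> 0"
    unfolding t_def using LIMSEQ_ignore_initial_segment[OF lim_const_over_n[of \<rho>], of 2] by simp
  define f where "f u = (\<Sum>j. b (j + n) * u ^ j)" for u
  have f_sums: "(\<lambda>j. b (j + n) * u ^ j) sums f u" if "norm u < (t 0)\<^sup>2" for u
  proof -
    have "summable (\<lambda>k. b k * ((t 0)\<^sup>2) ^ k)"
      using sums_summable[OF b[OF t(2)[of 0]]] by (simp add: power_mult)
    then have "summable (\<lambda>k. b k * u ^ k)"
      by (rule powser_inside) (use that in simp)
    then have "summable (\<lambda>k. b (k + n) * u ^ k)"
    proof (cases "u = 0")
      case False
      assume "summable (\<lambda>k. b k * u ^ k)"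
      then have "summable (\<lambda>k. b (k + n) * u ^ (k + n))"
        by (rule summable_ignore_initial_segment)
      then have "summable (\<lambda>k. u ^ n * (b (k + n) * u ^ k))"
        by (simp add: power_add ac_simps)
      then show ?thesis
        using False by (simp add: summable_cmult_iff)
    qed simp
    then show ?thesis
      unfolding f_def by (rule summable_sums)
  qed
  have f_lim: "(f \<longlongrightarrow> b n) (at 0)"
    using powser_limit_0[OF _ f_sums, where s = "(t 0)\<^sup>2"] t(1)[of 0] by simp
  have lim_ratio: "(\<lambda>m. expectation (\<lambda>x. cos_remainder n (t m * x) / t m ^ (2 * n))) \<longlonglongrightarrow> (-1) ^ n * b n"
  proof -
    have eq: "(-1) ^ n * f ((t m)\<^sup>2) = expectation (\<lambda>x. cos_remainder n (t m * x) / t m ^ (2 * n))" if "m > 0" for m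
    proof -
      have "t m < t 0"
        using that \<rho> by (auto simp: t_def field_simps)
      then have f: "(\<lambda>j. b (j + n) * ((t m)\<^sup>2) ^ j) sums f ((t m)\<^sup>2)"
        using t(1)[of m] by (intro f_sums) (simp add: power_strict_mono)
      have "(\<lambda>j. b (j + n) * (t m) ^ (2 * (j + n))) sums
          (expectation (\<lambda>x. cos (t m * x)) - (\<Sum>j<n. b j * t m ^ (2 * j)))"
        by (rule sums_split_initial_segment[OF b[OF t(2)]])
      moreover have "(\<lambda>j. b (j + n) * (t m) ^ (2 * (j + n))) = (\<lambda>j. t m ^ (2 * n) * (b (j + n) * ((t m)\<^sup>2) ^ j))"
        by (simp add: power_add ac_simps add_mult_distrib2 flip: power_mult)
      ultimately have "expectation (\<lambda>x. cos (t m * x)) - (\<Sum>j<n. b j * t m ^ (2 * j)) = t m ^ (2 * n) * f ((t m)\<^sup>2)"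
        using sums_unique2[OF _ sums_mult[OF f, of "t m ^ (2 * n)"]] by simp
      then show ?thesis
        using E_rem[of "t m"] t(1)[of m] by simp
    qed
    have "(\<lambda>m. (-1) ^ n * f ((t m)\<^sup>2)) \<longlonglongrightarrow> (-1) ^ n * b n"
    proof (intro tendsto_intros filterlim_compose[OF f_lim])
      have "(\<lambda>m. (t m)\<^sup>2) \<longlonglongrightarrow> 0\<^sup>2"
        by (intro tendsto_intros t_lim)
      then show "filterlim (\<lambda>m. (t m)\<^sup>2) (at 0) sequentially"
        using t(1) by (auto simp: filterlim_at less_imp_neq[symmetric])
    qed
    then show ?thesis
      by (rule Lim_transform_eventually) (use eq in \<open>auto intro!: eventually_sequentiallyI[of 1]\<close>)
  qed
  have ptw: "(\<lambda>m. cos_remainder n (t m * x) / t m ^ (2 * n)) \<longlonglongrightarrow> x ^ (2 * n) / fact (2 * n)" for x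
    using t(1) by (intro cos_remainder_asymptotic t_lim) (simp add: less_imp_neq[symmetric])
  have meas [measurable]: "(\<lambda>x. cos_remainder n (s * x)) \<in> borel_measurable M" for s
    using int_rem by (rule borel_measurable_integrable)
  have int: "integrable M (\<lambda>x. x ^ (2 * n) / fact (2 * n))"
  proof (cases "n = 0")
    case False
    have "(\<integral>\<^sup>+x. ennreal (x ^ (2 * n) / fact (2 * n)) \<partial>M)
        = (\<integral>\<^sup>+x. liminf (\<lambda>m. ennreal (cos_remainder n (t m * x) / t m ^ (2 * n))) \<partial>M)"
      by (intro nn_integral_cong lim_imp_Liminf[symmetric] tendsto_ennrealI ptw) simp
    also have "\<dots> \<le> liminf (\<lambda>m. \<integral>\<^sup>+x. ennreal (cos_remainder n (t m * x) / t m ^ (2 * n)) \<partial>M)"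
      by (intro nn_integral_liminf) measurable
    also have "(\<lambda>m. \<integral>\<^sup>+x. ennreal (cos_remainder n (t m * x) / t m ^ (2 * n)) \<partial>M)
        = (\<lambda>m. ennreal (expectation (\<lambda>x. cos_remainder n (t m * x) / t m ^ (2 * n))))"
      using False t(1) int_rem
      by (intro ext nn_integral_eq_integral) (auto intro!: divide_nonneg_nonneg cos_remainder_nonneg AE_I2)
    also have "liminf \<dots> = ennreal ((-1) ^ n * b n)"
      by (intro lim_imp_Liminf tendsto_ennrealI lim_ratio) simp
    finally show ?thesis
      by (intro integrableI_bounded) (auto simp: power_mult le_less_trans[OF _ ennreal_less_top])
  qed simp
  have "(\<lambda>m. expectation (\<lambda>x. cos_remainder n (t m * x) / t m ^ (2 * n)))
      \<longlonglongrightarrow> expectation (\<lambda>x. x ^ (2 * n) / fact (2 * n))"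
  proof (rule integral_dominated_convergence[where w = "\<lambda>x. x ^ (2 * n) / fact (2 * n)"])
    fix m
    have "norm (cos_remainder n (t m * x) / t m ^ (2 * n)) \<le> x ^ (2 * n) / fact (2 * n)" for x
      using abs_cos_remainder_le[of n "t m * x"] t(1)[of m]
      by (simp add: power_mult_distrib field_simps power_abs)
    then show "AE x in M. norm (cos_remainder n (t m * x) / t m ^ (2 * n)) \<le> x ^ (2 * n) / fact (2 * n)"
      by simp
  qed (use int ptw in auto)
  then have "expectation (\<lambda>x. x ^ (2 * n) / fact (2 * n)) = (-1) ^ n * b n"
    using lim_ratio LIMSEQ_unique by blast
  then show ?case
    using integrable_mult_right[OF int, of "fact (2 * n)"] by simp
qed

text \<open>The series is only assumed to represent the characteristic function near 0, but its interval of
  convergence may be larger. Since the terms of the cosh series are nonnegative and their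
  expectations are the absolute values of the terms of the given series, exponential moments exist on
  the whole interval of convergence.\<close>

lemma integrable_exp_abs_from_char_series:
  assumes \<delta>: "\<delta> > 0"
    and b: "\<And>t. \<bar>t\<bar> < \<delta> \<Longrightarrow> (\<lambda>k. b k * t ^ (2 * k)) sums expectation (\<lambda>x. cos (t * x))"
    and summable: "\<And>t. \<bar>t\<bar> < \<rho> \<Longrightarrow> summable (\<lambda>k. b k * t ^ (2 * k))"
    and y: "\<bar>y\<bar> < \<rho>"
  shows "integrable M (\<lambda>x. exp (y * \<bar>x\<bar>))"
proof -
  note mom = even_moments_from_char_series[OF \<delta> b]
  define f where "f k x = (y * x) ^ (2 * k) / fact (2 * k)" for k and x :: real
  have f_sums: "(\<lambda>k. f k x) sums cosh (y * x)" for x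
  proof -
    have "(\<lambda>k. \<Sum>i = k * 2..<k * 2 + 2. if even i then (y * x) ^ i /\<^sub>R fact i else 0) sums cosh (y * x)"
      by (rule sums_group[OF cosh_converges]) simp
    moreover have "(\<Sum>i = k * 2..<k * 2 + 2. if even i then (y * x) ^ i /\<^sub>R fact i else 0) = f k x" for k
    proof -
      have "{k * 2..<k * 2 + 2} = {2 * k, Suc (2 * k)}"
        by auto
      then show ?thesis
        by (simp add: f_def divide_inverse mult.commute)
    qed
    ultimately show ?thesis by simp
  qed
  have f_nonneg: "f k x \<ge> 0" for k x
    by (simp add: f_def)
  have "integrable M (\<lambda>x. \<Sum>k. f k x)"
  proof (rule integrable_suminf)
    show "integrable M (f k)" for k
      using mom[of k] by (simp add: f_def[abs_def] power_mult_distrib)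
    show "AE x in M. summable (\<lambda>k. norm (f k x))"
      using f_sums f_nonneg by (simp add: sums_iff)
    obtain z where z: "\<bar>y\<bar> < z" "z < \<rho>"
      using dense[OF y] by blast
    then have "summable (\<lambda>k. b k * (z\<^sup>2) ^ k)"
      using summable[of z] by (simp add: power_mult)
    then have "summable (\<lambda>k. norm (b k * (y\<^sup>2) ^ k))"
    proof (rule powser_insidea)
      show "norm (y\<^sup>2) < norm (z\<^sup>2)"
        using z power_strict_mono[of "\<bar>y\<bar>" z 2] by simp
    qed
    moreover have "norm (b k * (y\<^sup>2) ^ k) = (\<integral>x. norm (f k x) \<partial>M)" for k
    proof -
      have "(\<integral>x. norm (f k x) \<partial>M) = (\<integral>x. f k x \<partial>M)"
        using f_nonneg by simp
      also have "\<dots> = y ^ (2 * k) * (expectation (\<lambda>x. x ^ (2 * k)) / fact (2 * k))"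
        by (simp add: f_def power_mult_distrib)
      finally have *: "(\<integral>x. norm (f k x) \<partial>M) = y ^ (2 * k) * ((-1) ^ k * b k)"
        using mom[of k] by simp
      have "(\<integral>x. norm (f k x) \<partial>M) = \<bar>\<integral>x. norm (f k x) \<partial>M\<bar>"
        by simp
      also have "\<dots> = norm (b k * (y\<^sup>2) ^ k)"
        unfolding * by (simp add: abs_mult power_abs power_mult)
      finally show ?thesis ..
    qed
    ultimately show "summable (\<lambda>k. \<integral>x. norm (f k x) \<partial>M)" by simp
  qed
  then have int: "integrable M (\<lambda>x. 2 * cosh (y * x))"
    using f_sums by (simp add: sums_iff)
  show ?thesis
  proof (rule Bochner_Integration.integrable_bound[OF int])
    have "exp (y * \<bar>x\<bar>) \<le> 2 * cosh (y * x)" for x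
      by (cases "x \<ge> 0") (simp_all add: cosh_def)
    then show "AE x in M. norm (exp (y * \<bar>x\<bar>)) \<le> norm (2 * cosh (y * x))"
      by (auto simp: abs_of_pos cosh_real_pos intro!: AE_I2 order_trans[OF _ abs_ge_self])
  qed simp
qed

text \<open>The real part of a characteristic function is even, so it is represented by the even-order Taylor
  terms of \<open>H\<close>, which converge in the whole disk.\<close>

lemma integrable_exp_abs_if_char_analytic:
  assumes "\<rho> > 0" and hol: "H holomorphic_on ball 0 \<rho>"
    and H: "\<forall>\<^sub>F t in nhds 0. H (of_real t) = char M t" and y: "\<bar>y\<bar> < \<rho>"
  shows "integrable M (\<lambda>x. exp (y * \<bar>x\<bar>))"
proof -
  define a where "a k = Re ((deriv ^^ k) H 0 / fact k)" for k
  have a: "(\<lambda>k. a k * t ^ k) sums Re (H (of_real t))" if "\<bar>t\<bar> < \<rho>" for t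
  proof -
    have "(\<lambda>k. Re ((deriv ^^ k) H 0 / fact k * (of_real t - 0) ^ k)) sums Re (H (of_real t))"
      by (intro sums_Re holomorphic_power_series[OF hol]) (use that in simp)
    moreover have "Re ((deriv ^^ k) H 0 / fact k * (of_real t - 0) ^ k) = a k * t ^ k" for k
      unfolding a_def diff_0_right of_real_power[symmetric] times_complex.simps by simp
    ultimately show ?thesis by simp
  qed
  have even: "(\<lambda>k. a (2 * k) * t ^ (2 * k)) sums ((Re (H (of_real t)) + Re (H (of_real (- t)))) / 2)"
    if t: "\<bar>t\<bar> < \<rho>" for t
  proof -
    \<comment> \<open>Averaging over \<open>t\<close> and \<open>- t\<close> cancels the odd powers; grouping in pairs removes the zeros.\<close>
    have "(\<lambda>k. (a k * t ^ k + a k * (- t) ^ k) / 2) sums ((Re (H (of_real t)) + Re (H (of_real (- t)))) / 2)"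
      using t by (intro sums_divide sums_add a) auto
    then have "(\<lambda>k. \<Sum>i = k * 2..<k * 2 + 2. (a i * t ^ i + a i * (- t) ^ i) / 2) sums
        ((Re (H (of_real t)) + Re (H (of_real (- t)))) / 2)"
      by (rule sums_group) simp
    moreover have "(\<Sum>i = k * 2..<k * 2 + 2. (a i * t ^ i + a i * (- t) ^ i) / 2) = a (2 * k) * t ^ (2 * k)" for k
    proof -
      have "{k * 2..<k * 2 + 2} = {2 * k, Suc (2 * k)}"
        by auto
      then show ?thesis
        by simp
    qed
    ultimately show ?thesis by simp
  qed
  obtain d where "d > 0" and d: "\<And>t. \<bar>t\<bar> < d \<Longrightarrow> H (of_real t) = char M t"
    using H unfolding eventually_nhds_metric by (auto simp: dist_norm)
  have Re_char: "Re (char M t) = expectation (\<lambda>x. cos (t * x))" for t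
  proof -
    have "Re (char M t) = expectation (\<lambda>x. Re (iexp (t * x)))"
      unfolding char_def by (rule integral_Re[symmetric]) (simp add: integrable_iexp)
    then show ?thesis by (simp add: Re_exp)
  qed
  show ?thesis
  proof (rule integrable_exp_abs_from_char_series[where b = "\<lambda>k. a (2 * k)" and \<rho> = \<rho> and \<delta> = "min d \<rho>"])
    fix t :: real assume "\<bar>t\<bar> < min d \<rho>"
    then show "(\<lambda>k. a (2 * k) * t ^ (2 * k)) sums expectation (\<lambda>x. cos (t * x))"
      using even[of t] d[of t] d[of "- t"] by (simp add: Re_char)
  qed (use assms(1) \<open>d > 0\<close> y even in \<open>auto simp: sums_iff\<close>)
qed

text \<open>Differentiation under the expectation. With \<open>\<delta>\<close> a third of the distance from \<open>s\<close> to the boundary of the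
  strip, one \<open>\<delta>\<close> pays for moving \<open>s\<close> within its disk and a second one for the factor \<open>\<bar>x\<bar>\<close> that comes
  from the derivative, and the dominating function is still integrable.\<close>

lemma holomorphic_moment_generating_function:
  assumes exp_int: "\<And>y. \<bar>y\<bar> < \<rho> \<Longrightarrow> integrable M (\<lambda>x. exp (y * \<bar>x\<bar>))"
  shows "(\<lambda>s. CLINT x|M. exp (s * of_real x)) holomorphic_on {s. \<bar>Re s\<bar> < \<rho>}"
proof -
  define \<Phi> where "\<Phi> s = (CLINT x|M. exp (s * of_real x))" for s
  have Re_le: "Re w * x \<le> \<bar>Re w\<bar> * \<bar>x\<bar>" for w and x :: real
    by (metis abs_ge_self abs_mult)
  have int: "integrable M (\<lambda>x. exp (s * of_real x))" if "\<bar>Re s\<bar> < \<rho>" for s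
  proof (rule Bochner_Integration.integrable_bound[OF exp_int[of "\<bar>Re s\<bar>"]])
    show "AE x in M. norm (exp (s * of_real x)) \<le> norm (exp (\<bar>Re s\<bar> * \<bar>x\<bar>))"
      using Re_le by (simp add: norm_exp_eq_Re)
  qed (use that in auto)
  have "\<Phi> field_differentiable (at s)" if s: "\<bar>Re s\<bar> < \<rho>" for s
  proof -
    define \<delta> where "\<delta> = (\<rho> - \<bar>Re s\<bar>) / 3"
    have "\<delta> > 0" using s by (simp add: \<delta>_def)
    define w where "w x = exp ((\<bar>Re s\<bar> + 2 * \<delta>) * \<bar>x\<bar>) / \<delta>" for x
    have "integrable M w"
      unfolding w_def using s by (intro integrable_divide exp_int) (simp add: \<delta>_def field_simps)
    have bound: "norm ((exp (z * of_real x) - exp (s * of_real x)) / (z - s)) \<le> w x"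
      if z: "z \<in> ball s \<delta> - {s}" for x z
    proof -
      have zs: "norm (z - s) < \<delta>" "z \<noteq> s"
        using z by (auto simp: dist_norm norm_minus_commute)
      define h where "h = (z - s) * of_real x"
      have nh: "norm h \<le> \<delta> * \<bar>x\<bar>"
        using zs by (simp add: h_def norm_mult mult_right_mono)
      have "norm (exp h - exp 0) \<le> exp (norm h) * norm (h - 0)"
      proof (rule field_differentiable_bound[where S = "cball 0 (norm h)" and f' = exp])
        show "norm (exp u) \<le> exp (norm h)" if "u \<in> cball 0 (norm h)" for u :: complex
          using that complex_Re_le_cmod[of u] by (simp add: norm_exp_eq_Re)
      qed (auto intro: DERIV_exp has_field_derivative_at_within)
      also have "\<dots> \<le> exp (\<delta> * \<bar>x\<bar>) * (norm (z - s) * \<bar>x\<bar>)"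
        using nh by (intro mult_mono) (auto simp: h_def norm_mult)
      also have "\<dots> \<le> exp (\<delta> * \<bar>x\<bar>) * (norm (z - s) * (exp (\<delta> * \<bar>x\<bar>) / \<delta>))"
      proof (intro mult_left_mono)
        have "\<delta> * \<bar>x\<bar> \<le> exp (\<delta> * \<bar>x\<bar>)"
          using exp_ge_add_one_self[of "\<delta> * \<bar>x\<bar>"] by linarith
        then show "\<bar>x\<bar> \<le> exp (\<delta> * \<bar>x\<bar>) / \<delta>"
          using \<open>\<delta> > 0\<close> by (simp add: field_simps)
      qed auto
      finally have "norm (exp h - 1) / norm (z - s) \<le> exp (2 * \<delta> * \<bar>x\<bar>) / \<delta>"
        using zs by (simp add: field_simps flip: exp_add)
      moreover have "norm (exp (s * of_real x)) \<le> exp (\<bar>Re s\<bar> * \<bar>x\<bar>)"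
        using Re_le by (simp add: norm_exp_eq_Re)
      ultimately have "norm (exp (s * of_real x)) * (norm (exp h - 1) / norm (z - s))
          \<le> exp (\<bar>Re s\<bar> * \<bar>x\<bar>) * (exp (2 * \<delta> * \<bar>x\<bar>) / \<delta>)"
        by (intro mult_mono) auto
      moreover have "exp (z * of_real x) - exp (s * of_real x) = exp (s * of_real x) * (exp h - 1)"
        by (simp add: h_def algebra_simps flip: exp_add)
      ultimately have "norm (exp (s * of_real x)) * (norm (exp h - 1) / norm (z - s))
          \<le> exp (\<bar>Re s\<bar> * \<bar>x\<bar>) * (exp (2 * \<delta> * \<bar>x\<bar>) / \<delta>)"
        and "exp (z * of_real x) - exp (s * of_real x) = exp (s * of_real x) * (exp h - 1)"
        by blast+
      moreover from this(2) have "norm ((exp (z * of_real x) - exp (s * of_real x)) / (z - s))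
          = norm (exp (s * of_real x)) * (norm (exp h - 1) / norm (z - s))"
        by (simp only: norm_mult norm_divide times_divide_eq_right)
      moreover have "w x = exp (\<bar>Re s\<bar> * \<bar>x\<bar>) * (exp (2 * \<delta> * \<bar>x\<bar>) / \<delta>)"
        by (simp add: w_def ring_distribs exp_add)
      ultimately show ?thesis
        by simp
    qed
    have "((\<lambda>z. (\<Phi> z - \<Phi> s) / (z - s)) \<longlongrightarrow> (CLINT x|M. of_real x * exp (s * of_real x))) (at s within ball s \<delta>)"
      unfolding tendsto_at_iff_sequentially
    proof (intro allI impI)
      fix Z :: "nat \<Rightarrow> complex" assume Z: "\<forall>i. Z i \<in> ball s \<delta> - {s}" "Z \<longlonglongrightarrow> s"
      have "((\<lambda>z. (\<Phi> z - \<Phi> s) / (z - s)) \<circ> Z) = (\<lambda>i. CLINT x|M. (exp (Z i * of_real x) - exp (s * of_real x)) / (Z i - s))"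
      proof
        fix i
        have "\<bar>Re (Z i)\<bar> \<le> \<bar>Re s\<bar> + norm (Z i - s)"
          using abs_Re_le_cmod[of "Z i - s"] by simp
        then have "\<bar>Re (Z i)\<bar> < \<rho>"
          using Z(1)[rule_format, of i] s by (auto simp: \<delta>_def dist_norm norm_minus_commute)
        then show "((\<lambda>z. (\<Phi> z - \<Phi> s) / (z - s)) \<circ> Z) i = (CLINT x|M. (exp (Z i * of_real x) - exp (s * of_real x)) / (Z i - s))"
          using int s by (simp add: \<Phi>_def)
      qed
      also have "\<dots> \<longlonglongrightarrow> (CLINT x|M. of_real x * exp (s * of_real x))"
      proof (rule integral_dominated_convergence[where w = w])
        have "((\<lambda>z. (exp (z * of_real x) - exp (s * of_real x)) / (z - s)) \<longlongrightarrow> of_real x * exp (s * of_real x)) (at s)" for x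
        proof -
          have "((\<lambda>z. exp (z * of_real x)) has_field_derivative of_real x * exp (s * of_real x)) (at s)"
            by (auto intro!: derivative_eq_intros)
          then show ?thesis by (simp add: has_field_derivative_iff)
        qed
        moreover have "filterlim Z (at s) sequentially"
          using Z by (auto simp: filterlim_at)
        ultimately show "AE x in M. (\<lambda>i. (exp (Z i * of_real x) - exp (s * of_real x)) / (Z i - s)) \<longlonglongrightarrow> of_real x * exp (s * of_real x)"
          using filterlim_compose by (intro AE_I2) blast
      qed (use \<open>integrable M w\<close> bound Z(1) in auto)
      finally show "((\<lambda>z. (\<Phi> z - \<Phi> s) / (z - s)) \<circ> Z) \<longlonglongrightarrow> (CLINT x|M. of_real x * exp (s * of_real x))" .
    qed
    then have "(\<Phi> has_field_derivative (CLINT x|M. of_real x * exp (s * of_real x))) (at s within ball s \<delta>)"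
      by (simp add: has_field_derivative_iff)
    then show ?thesis
      using \<open>\<delta> > 0\<close> by (auto simp: field_differentiable_def at_within_open[of s "ball s \<delta>"])
  qed
  then show ?thesis
    unfolding \<Phi>_def[symmetric] holomorphic_on_def by (auto intro: field_differentiable_at_within)
qed

end

section \<open>Power series with finitely many different coefficients\<close>

definition shifted_series :: "(nat \<Rightarrow> complex) \<Rightarrow> nat \<Rightarrow> complex \<Rightarrow> complex" where
  "shifted_series c n z = (\<Sum>k. c (n + k) * z ^ k)"

lemma
  assumes "\<forall>k. norm (c k) \<le> A" and "norm z < 1"
  shows summable_shifted_series: "summable (\<lambda>k. c (n + k) * z ^ k)"
    and norm_shifted_series_le: "norm (shifted_series c n z) \<le> A / (1 - norm z)"
proof -
  have le: "norm (c (n + k) * z ^ k) \<le> A * norm z ^ k" for k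
    using assms(1) by (simp add: norm_mult norm_power mult_right_mono)
  have geo: "(\<lambda>k. A * norm z ^ k) sums (A * (1 / (1 - norm z)))"
    using assms(2) by (intro sums_mult geometric_sums) simp
  have sm: "summable (\<lambda>k. norm (c (n + k) * z ^ k))"
    by (rule summable_comparison_test'[OF sums_summable[OF geo]]) (use le in auto)
  then show "summable (\<lambda>k. c (n + k) * z ^ k)"
    by (rule summable_norm_cancel)
  have "norm (shifted_series c n z) \<le> (\<Sum>k. norm (c (n + k) * z ^ k))"
    unfolding shifted_series_def by (rule summable_norm[OF sm])
  also have "\<dots> \<le> (\<Sum>k. A * norm z ^ k)"
    by (rule suminf_le[OF le sm sums_summable[OF geo]])
  finally show "norm (shifted_series c n z) \<le> A / (1 - norm z)"
    using geo by (simp add: sums_iff)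
qed

lemma holomorphic_shifted_series:
  assumes "\<forall>k. norm (c k) \<le> A"
  shows "shifted_series c n holomorphic_on ball 0 1"
proof (rule power_series_holomorphic)
  fix w :: complex assume "w \<in> ball 0 1"
  then show "(\<lambda>k. c (n + k) * (w - 0) ^ k) sums shifted_series c n w"
    using summable_shifted_series[OF assms, where z = w and n = n] by (simp add: shifted_series_def summable_sums)
qed

lemma shifted_series_0 [simp]: "shifted_series c n 0 = c n"
  unfolding shifted_series_def using powser_zero[of "\<lambda>k. c (n + k)"] by simp

lemma shifted_series_split:
  assumes "\<forall>k. norm (c k) \<le> A" and "norm z < 1"
  shows "shifted_series c 0 z = (\<Sum>k<n. c k * z ^ k) + z ^ n * shifted_series c n z"
proof -
  have "shifted_series c 0 z = (\<Sum>k. c (k + n) * z ^ (k + n)) + (\<Sum>k<n. c k * z ^ k)"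
    unfolding shifted_series_def
    using suminf_split_initial_segment[OF summable_shifted_series[OF assms, where n = 0], where k = n]
    by simp
  also have "(\<Sum>k. c (k + n) * z ^ (k + n)) = (\<Sum>k. z ^ n * (c (n + k) * z ^ k))"
    by (simp add: power_add algebra_simps)
  also have "\<dots> = z ^ n * shifted_series c n z"
    unfolding shifted_series_def
    by (rule suminf_mult[OF summable_shifted_series[OF assms]])
  finally show ?thesis by simp
qed

text \<open>The quadratic vanishes at the two points where the circle around \<open>\<zeta>\<close> meets the unit circle, and on
  the former circle its size measures the distance to the latter. As a multiplier it therefore
  compensates the blow-up of geometric series at the unit circle.\<close>

lemma norm_circle_quadratic:
  assumes "norm \<zeta> = 1" and "dist \<zeta> z = \<rho>" and "\<rho> > 0"
  shows "norm (cnj \<zeta> * z\<^sup>2 + ((of_real \<rho>)\<^sup>2 - 2) * z + \<zeta>) = \<rho> * \<bar>(norm z)\<^sup>2 - 1\<bar>"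
proof -
  have "cnj \<zeta> * \<zeta> = 1"
    using assms(1) complex_norm_square[of \<zeta>] by (simp add: mult.commute)
  moreover have "(of_real \<rho>)\<^sup>2 = (z - \<zeta>) * (cnj z - cnj \<zeta>)"
    using complex_norm_square[of "z - \<zeta>"] assms(2) by (simp add: dist_norm norm_minus_commute)
  ultimately have "cnj \<zeta> * z\<^sup>2 + ((of_real \<rho>)\<^sup>2 - 2) * z + \<zeta> = (z - \<zeta>) * (z * cnj z - 1)"
    by algebra
  also have "z * cnj z = of_real ((norm z)\<^sup>2)"
    using complex_norm_square[of z] by simp
  finally show ?thesis
    using assms(2) norm_of_real[of "(norm z)\<^sup>2 - 1", where 'a = complex]
    by (simp add: norm_mult dist_norm norm_minus_commute)
qed

text \<open>M. Riesz's argument. Inside the unit disk the quotient is the shifted series, of size at most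
  \<open>A / (1 - norm z)\<close>; outside, the partial sum divided by \<open>z ^ n\<close> is at most \<open>A / (norm z - 1)\<close>. After
  multiplication with the quadratic \<open>q\<close> of the preceding lemma both bounds become uniform in \<open>n\<close> on
  the circle of radius \<open>\<rho>\<close> around \<open>\<zeta>\<close>, and the maximum principle carries the bound into the disk. Near
  the centre \<open>\<zeta>\<close> the factor \<open>q\<close> is bounded away from zero.\<close>

lemma Riesz_bounded_continuation:
  assumes bounded: "\<forall>k. norm (c k) \<le> A"
    and \<zeta>: "norm \<zeta> = 1" and \<rho>: "0 < \<rho>" "\<rho> < 1"
    and hol: "L holomorphic_on ball \<zeta> \<rho>" and cont: "continuous_on (cball \<zeta> \<rho>) L"
    and L: "\<And>z. \<lbrakk>z \<in> cball \<zeta> \<rho>; norm z < 1\<rbrakk> \<Longrightarrow> L z = shifted_series c 0 z"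
  shows "\<exists>\<rho>'>0. \<rho>' \<le> \<rho> \<and>
    (\<exists>B. \<forall>n. \<forall>z\<in>ball \<zeta> \<rho>'. norm ((L z - (\<Sum>k<n. c k * z ^ k)) / z ^ n) \<le> B)"
proof -
  define q where "q z = cnj \<zeta> * z\<^sup>2 + ((of_real \<rho>)\<^sup>2 - 2) * z + \<zeta>" for z
  define F where "F n z = (L z - (\<Sum>k<n. c k * z ^ k)) / z ^ n" for n z
  have nz: "z \<noteq> 0" if "z \<in> cball \<zeta> \<rho>" for z
    using that \<zeta> \<rho> by auto
  have "compact (L ` cball \<zeta> \<rho>)"
    by (intro compact_continuous_image cont compact_cball)
  then obtain C where "C > 0" and C: "\<And>z. z \<in> cball \<zeta> \<rho> \<Longrightarrow> norm (L z) \<le> C"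
    using compact_imp_bounded[of "L ` cball \<zeta> \<rho>"] unfolding bounded_pos by auto
  have "A \<ge> 0"
    using bounded norm_ge_zero order_trans by blast
  define B where "B = 3 * C + 3 * A"
  have sphere: "norm (q z * F n z) \<le> B" if z: "dist \<zeta> z = \<rho>" for z n
  proof -
    have q: "norm (q z) = \<rho> * \<bar>(norm z)\<^sup>2 - 1\<bar>"
      unfolding q_def by (rule norm_circle_quadratic[OF \<zeta> z \<rho>(1)])
    have zc: "z \<in> cball \<zeta> \<rho>" and z0: "z \<noteq> 0"
      using z nz[of z] by auto
    have z2: "norm z \<le> 2"
      using norm_triangle_ineq2[of z \<zeta>] z \<zeta> \<rho> by (simp add: dist_norm norm_minus_commute)
    consider "norm z < 1" | "norm z = 1" | "norm z > 1" by linarith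
    then show ?thesis
    proof cases
      case 1
      have "F n z = shifted_series c n z"
        using L[OF zc 1] shifted_series_split[OF bounded 1, of n] z0 by (simp add: F_def)
      then have "norm (F n z) \<le> A / (1 - norm z)"
        using norm_shifted_series_le[OF bounded 1] by simp
      moreover have "norm (q z) = \<rho> * (1 - norm z) * (1 + norm z)"
        using 1 q abs_square_less_1[of "norm z"] by (simp add: power2_eq_square algebra_simps)
      ultimately have "norm (q z * F n z) \<le> \<rho> * (1 - norm z) * (1 + norm z) * (A / (1 - norm z))"
        unfolding norm_mult using 1 \<rho> by (metis mult_left_mono norm_ge_zero)
      also have "\<dots> = \<rho> * (1 + norm z) * A"
        using 1 by (simp add: field_simps)
      also have "\<dots> \<le> 1 * 3 * A"
        using 1 \<rho> \<open>A \<ge> 0\<close> by (intro mult_mono) auto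
      finally show ?thesis
        using \<open>C > 0\<close> by (simp add: B_def)
    next
      case 2
      then have "q z = 0" using q by simp
      then show ?thesis
        using \<open>C > 0\<close> \<open>A \<ge> 0\<close> by (simp add: B_def)
    next
      case 3
      have "norm (\<Sum>k<n. c k * z ^ k) \<le> (\<Sum>k<n. A * norm z ^ k)"
        by (rule sum_norm_le) (simp add: norm_mult norm_power mult_right_mono bounded)
      also have "\<dots> = A * ((norm z ^ n - 1) / (norm z - 1))"
        using 3 geometric_sum[of "norm z" n] by (simp flip: sum_distrib_left)
      also have "\<dots> \<le> A * (norm z ^ n / (norm z - 1))"
        using 3 \<open>A \<ge> 0\<close> by (intro mult_left_mono divide_right_mono) auto
      finally have "norm (L z - (\<Sum>k<n. c k * z ^ k)) \<le> C * norm z ^ n + A * (norm z ^ n / (norm z - 1))"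
      proof -
        assume S: "norm (\<Sum>k<n. c k * z ^ k) \<le> A * (norm z ^ n / (norm z - 1))"
        have "C * 1 \<le> C * norm z ^ n"
          using 3 \<open>C > 0\<close> by (intro mult_left_mono one_le_power) auto
        with S C[OF zc] norm_triangle_ineq4[of "L z" "\<Sum>k<n. c k * z ^ k"] show ?thesis
          by linarith
      qed
      then have "norm (F n z) \<le> C + A / (norm z - 1)"
        using 3 z0 by (simp add: F_def norm_divide norm_power field_simps)
      moreover have "norm (q z) = \<rho> * (norm z - 1) * (norm z + 1)"
        using 3 q one_le_power[of "norm z" 2] by (simp add: power2_eq_square algebra_simps)
      ultimately have "norm (q z * F n z) \<le> \<rho> * (norm z - 1) * (norm z + 1) * (C + A / (norm z - 1))"
        unfolding norm_mult using 3 \<rho> by (metis mult_left_mono norm_ge_zero)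
      also have "\<dots> = \<rho> * (norm z - 1) * (norm z + 1) * C + \<rho> * (norm z + 1) * A"
        using 3 by (simp add: field_simps)
      also have "\<dots> \<le> 1 * 1 * 3 * C + 1 * 3 * A"
        using 3 \<rho> z2 \<open>A \<ge> 0\<close> \<open>C > 0\<close> by (intro add_mono mult_mono) auto
      finally show ?thesis
        by (simp add: B_def)
    qed
  qed
  have Fcont: "continuous_on (cball \<zeta> \<rho>) (\<lambda>z. q z * F n z)" for n
    unfolding q_def F_def by (intro continuous_intros cont) (use nz in auto)
  have Fhol: "(\<lambda>z. q z * F n z) holomorphic_on ball \<zeta> \<rho>" for n
    unfolding q_def F_def by (intro holomorphic_intros hol) (use nz in auto)
  have disc: "norm (q z * F n z) \<le> B" if "z \<in> cball \<zeta> \<rho>" for z n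
  proof (rule maximum_modulus_frontier[where S = "cball \<zeta> \<rho>" and f = "\<lambda>z. q z * F n z"])
    show "norm (q w * F n w) \<le> B" if "w \<in> frontier (cball \<zeta> \<rho>)" for w
      using that \<rho> sphere[of w n] by simp
  qed (use Fcont Fhol that in auto)
  have q\<zeta>: "norm (q \<zeta>) = \<rho>\<^sup>2"
  proof -
    have "cnj \<zeta> * \<zeta> = 1"
      using \<zeta> complex_norm_square[of \<zeta>] by (simp add: mult.commute)
    then have "q \<zeta> = (of_real \<rho>)\<^sup>2 * \<zeta>"
      unfolding q_def by algebra
    then show ?thesis using \<zeta> \<rho> by (simp add: norm_mult norm_power)
  qed
  have "isCont q \<zeta>"
    unfolding q_def by (intro continuous_intros)
  then obtain d where "d > 0" and d: "\<And>z. dist z \<zeta> < d \<Longrightarrow> dist (q z) (q \<zeta>) < \<rho>\<^sup>2 / 2"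
    unfolding continuous_at_eps_delta using \<rho> by (metis half_gt_zero zero_less_power)
  have "norm ((L z - (\<Sum>k<n. c k * z ^ k)) / z ^ n) \<le> 2 * B / \<rho>\<^sup>2"
    if z: "z \<in> ball \<zeta> (min d \<rho>)" for n z
  proof -
    have "\<rho>\<^sup>2 / 2 \<le> norm (q z)"
      using z d[of z] q\<zeta> norm_triangle_ineq2[of "q \<zeta>" "q z"] by (simp add: dist_norm norm_minus_commute)
    then have "\<rho>\<^sup>2 / 2 * norm (F n z) \<le> norm (q z * F n z)"
      unfolding norm_mult by (intro mult_right_mono) auto
    also have "\<dots> \<le> B"
      using disc[of z n] z by auto
    finally show ?thesis
      using \<rho> by (simp add: F_def field_simps)
  qed
  moreover have "0 < min d \<rho>" "min d \<rho> \<le> \<rho>"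
    using \<open>d > 0\<close> \<rho> by auto
  ultimately show ?thesis
    by blast
qed

text \<open>By the pigeonhole principle two blocks of length \<open>k\<close> coincide. Since the sequence is not eventually
  periodic, the agreement that starts with these blocks ends at some first later place \<open>j\<close>.\<close>

lemma non_periodic_long_agreement:
  fixes c :: "nat \<Rightarrow> 'a" and k :: nat
  assumes "finite (range c)" and "\<And>N p. p > 0 \<Longrightarrow> \<exists>n\<ge>N. c (n + p) \<noteq> c n"
  shows "\<exists>m n j. k \<le> j \<and> (\<forall>i<j. c (m + i) = c (n + i)) \<and> c (m + j) \<noteq> c (n + j)"
proof -
  define block where "block n = map (\<lambda>i. c (n + i)) [0..<k]" for n
  have "range block \<subseteq> {xs. set xs \<subseteq> range c \<and> length xs = k}"
    by (auto simp: block_def)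
  then have "finite (range block)"
    using finite_lists_length_eq[OF assms(1)] finite_subset by blast
  then have "\<not> inj block"
    using finite_imageD infinite_UNIV_nat by blast
  then obtain m n where "m < n" and eq: "block m = block n"
    unfolding inj_def by (metis linorder_neq_iff)
  obtain l where "l \<ge> m" "c (l + (n - m)) \<noteq> c l"
    using assms(2)[of "n - m" m] \<open>m < n\<close> by auto
  then have ex: "\<exists>j. c (m + j) \<noteq> c (n + j)"
    using \<open>m < n\<close> by (intro exI[of _ "l - m"]) (auto simp: add.commute)
  define j where "j = (LEAST j. c (m + j) \<noteq> c (n + j))"
  have "c (m + j) \<noteq> c (n + j)"
    unfolding j_def using ex by (rule LeastI_ex)
  moreover have "\<forall>i<j. c (m + i) = c (n + i)"
    unfolding j_def using not_less_Least by blast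
  moreover have "k \<le> j"
  proof (rule ccontr)
    assume "\<not> k \<le> j"
    then have "block m ! j = block n ! j" "j < k" using eq by auto
    then show False using \<open>c (m + j) \<noteq> c (n + j)\<close> by (simp add: block_def)
  qed
  ultimately show ?thesis by blast
qed

text \<open>Suppose that the coefficients are not eventually periodic. For every \<open>k\<close> there are two shifts of the
  series whose difference has the form \<open>z ^ j * H k z\<close> with \<open>j \<ge> k\<close>, where \<open>H k 0\<close> is a nonzero difference of two
  coefficients and hence bounded away from 0. By the boundedness lemma the shifts, and the functions
  \<open>H k\<close>, which are themselves differences of shifts, form a normal family on the union of the unit disk with a
  disk around \<open>\<zeta>\<close>. Beyond the unit circle the factor \<open>z ^ j\<close> forces \<open>H k z\<close> to tend to 0, so
  the limit function vanishes there and thus everywhere, contradicting its value at 0.\<close>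

theorem Szego_finite_coefficients:
  assumes fin: "finite (range c)" and \<zeta>: "norm \<zeta> = 1" and R: "R > 0"
    and hol: "L holomorphic_on ball \<zeta> R"
    and L: "\<And>z. \<lbrakk>z \<in> ball \<zeta> R; norm z < 1\<rbrakk> \<Longrightarrow> L z = shifted_series c 0 z"
  shows "\<exists>N p. p > 0 \<and> (\<forall>n\<ge>N. c (n + p) = c n)"
proof (rule ccontr)
  assume "\<not> ?thesis"
  then have nonper: "\<exists>n\<ge>N. c (n + p) \<noteq> c n" if "p > 0" for N p
    using that by blast
  obtain A where A: "\<forall>k. norm (c k) \<le> A"
    using finite_imp_bounded[OF fin] unfolding bounded_iff by auto
  have A0: "A \<ge> 0"
    using A norm_ge_zero order_trans by blast
  define \<rho>\<^sub>0 where "\<rho>\<^sub>0 = min (R / 2) (1 / 2)"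
  have "0 < \<rho>\<^sub>0" "\<rho>\<^sub>0 < 1" and sub: "cball \<zeta> \<rho>\<^sub>0 \<subseteq> ball \<zeta> R"
    using R by (auto simp: \<rho>\<^sub>0_def)
  have "L holomorphic_on ball \<zeta> \<rho>\<^sub>0"
    using hol sub ball_subset_cball holomorphic_on_subset by (metis order_trans)
  moreover have "continuous_on (cball \<zeta> \<rho>\<^sub>0) L"
    using hol sub holomorphic_on_imp_continuous_on holomorphic_on_subset by blast
  moreover have "L z = shifted_series c 0 z" if "z \<in> cball \<zeta> \<rho>\<^sub>0" "norm z < 1" for z
    using L sub that by blast
  ultimately obtain \<rho> B where \<rho>: "0 < \<rho>" "\<rho> \<le> \<rho>\<^sub>0"
    and B': "\<forall>n. \<forall>z\<in>ball \<zeta> \<rho>. norm ((L z - (\<Sum>k<n. c k * z ^ k)) / z ^ n) \<le> B"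
    using Riesz_bounded_continuation[OF A \<zeta> \<open>0 < \<rho>\<^sub>0\<close> \<open>\<rho>\<^sub>0 < 1\<close>, of L] by metis
  then have B: "norm ((L z - (\<Sum>k<n. c k * z ^ k)) / z ^ n) \<le> B" if "z \<in> ball \<zeta> \<rho>" for n z
    using that by blast
  have subR: "ball \<zeta> \<rho> \<subseteq> ball \<zeta> R"
    using \<rho> by (auto simp: \<rho>\<^sub>0_def)
  have \<rho>1: "\<rho> < 1" using \<rho> \<open>\<rho>\<^sub>0 < 1\<close> by simp
  have nz: "z \<noteq> 0" if "z \<in> ball \<zeta> \<rho>" for z
    using that \<zeta> \<rho>1 by auto
  \<comment> \<open>\<open>F n\<close> is the analytic continuation of the \<open>n\<close>-th shift of the series to \<open>\<Omega>\<close>.\<close>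
  define F where "F n z = (if z \<in> ball \<zeta> \<rho> then (L z - (\<Sum>k<n. c k * z ^ k)) / z ^ n
                           else shifted_series c n z)" for n z
  define \<Omega> where "\<Omega> = ball \<zeta> \<rho> \<union> ball 0 1"
  have F_in: "F n z = shifted_series c n z" if "z \<in> ball 0 1" for n z
  proof (cases "z \<in> ball \<zeta> \<rho>")
    case True
    then have "L z = shifted_series c 0 z"
      using L[of z] subR that by auto
    then show ?thesis
      using shifted_series_split[OF A, of z n] that nz[OF True] True by (simp add: F_def)
  qed (simp add: F_def)
  have F_hol: "F n holomorphic_on \<Omega>" for n
    unfolding \<Omega>_def
  proof (rule holomorphic_on_Un)
    have "(\<lambda>z. (L z - (\<Sum>k<n. c k * z ^ k)) / z ^ n) holomorphic_on ball \<zeta> \<rho>"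
      using subR by (intro holomorphic_intros holomorphic_on_subset[OF hol]) (use nz in auto)
    then show "F n holomorphic_on ball \<zeta> \<rho>"
      by (rule holomorphic_transform) (simp add: F_def)
    show "F n holomorphic_on ball 0 1"
      using holomorphic_shifted_series[OF A] by (rule holomorphic_transform) (simp add: F_in)
  qed auto
  have F_shift: "F m z - F n z = z ^ j * (F (m + j) z - F (n + j) z)"
    if "z \<in> ball \<zeta> \<rho>" "\<forall>i<j. c (m + i) = c (n + i)" for m n j z
  proof -
    have *: "F m z = (\<Sum>i<j. c (m + i) * z ^ i) + z ^ j * F (m + j) z" for m
    proof -
      have "(\<Sum>k<m + j. c k * z ^ k) = (\<Sum>k<m. c k * z ^ k) + z ^ m * (\<Sum>i<j. c (m + i) * z ^ i)"
        by (induction j) (simp_all add: algebra_simps power_add)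
      then show ?thesis
        using that(1) nz[OF that(1)] by (simp add: F_def power_add field_simps)
    qed
    show ?thesis
      unfolding *[of m] *[of n] using that(2) by (simp add: algebra_simps)
  qed
  have F_bdd: "\<exists>B. \<forall>n. \<forall>z\<in>K. norm (F n z) \<le> B" if K: "compact K" "K \<subseteq> \<Omega>" for K
  proof -
    have "compact (K - ball \<zeta> \<rho>)"
      using K by (intro compact_diff) auto
    moreover have "K - ball \<zeta> \<rho> \<subseteq> ball 0 1"
      using K by (auto simp: \<Omega>_def)
    ultimately obtain s where s: "s < 1" "K - ball \<zeta> \<rho> \<subseteq> cball 0 s"
    proof (cases "K - ball \<zeta> \<rho> = {}")
      case False
      have "continuous_on (K - ball \<zeta> \<rho>) norm"
        by (intro continuous_intros)
      then obtain x where "x \<in> K - ball \<zeta> \<rho>" "\<forall>y\<in>K - ball \<zeta> \<rho>. norm y \<le> norm x"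
        using continuous_attains_sup[OF \<open>compact (K - ball \<zeta> \<rho>)\<close> False] by blast
      moreover from this have "norm x < 1"
        using \<open>K - ball \<zeta> \<rho> \<subseteq> ball 0 1\<close> by (metis mem_ball_0 subsetD)
      ultimately show ?thesis
        by (intro that[of "norm x"]) (auto simp del: mem_ball)
    qed (use that[of 0] in auto)
    have "norm (F n z) \<le> max B (A / (1 - s))" if "z \<in> K" for n z
    proof (cases "z \<in> ball \<zeta> \<rho>")
      case True
      then show ?thesis using B[OF True, of n] by (simp add: F_def)
    next
      case False
      then have z: "norm z \<le> s" using s that by auto
      have "norm (F n z) \<le> A / (1 - norm z)"
        using False norm_shifted_series_le[OF A, of z n] z s by (simp add: F_def)
      also have "\<dots> \<le> A / (1 - s)"
        using z s A0 by (intro divide_left_mono mult_pos_pos) linarith+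
      finally show ?thesis by simp
    qed
    then show ?thesis by blast
  qed
  obtain m n j where mnj: "\<And>k. k \<le> j k" "\<And>k. \<forall>i<j k. c (m k + i) = c (n k + i)"
    "\<And>k. c (m k + j k) \<noteq> c (n k + j k)"
    using non_periodic_long_agreement[OF fin nonper] by metis
  define H where "H k z = F (m k + j k) z - F (n k + j k) z" for k z
  have "open \<Omega>"
    unfolding \<Omega>_def by (intro open_Un open_ball)
  have "\<exists>G r. G holomorphic_on \<Omega> \<and> strict_mono r \<and> (\<forall>z\<in>\<Omega>. (\<lambda>k. H (r k) z) \<longlonglongrightarrow> G z)"
  proof (rule Montel[of \<Omega> "range H" H])
    show "h holomorphic_on \<Omega>" if "h \<in> range H" for h
      using that F_hol unfolding H_def by (auto intro!: holomorphic_intros)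
    show "\<exists>B. \<forall>h\<in>range H. \<forall>z\<in>K. norm (h z) \<le> B" if K: "compact K" "K \<subseteq> \<Omega>" for K
    proof -
      obtain B where "\<And>n z. z \<in> K \<Longrightarrow> norm (F n z) \<le> B"
        using F_bdd[OF K] by blast
      then have "norm (H k z) \<le> B + B" if "z \<in> K" for k z
        unfolding H_def using that by (intro norm_triangle_le_diff add_mono) auto
      then show ?thesis by blast
    qed
  qed (use \<open>open \<Omega>\<close> in auto)
  then obtain G r where G: "G holomorphic_on \<Omega>" and "strict_mono r"
    and lim: "\<And>z. z \<in> \<Omega> \<Longrightarrow> (\<lambda>k. H (r k) z) \<longlonglongrightarrow> G z"
    by blast
  define V where "V = ball \<zeta> \<rho> \<inter> {z. norm z > 1}"
  have G_out: "G z = 0" if z: "z \<in> V" for z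
  proof -
    have z1: "z \<in> ball \<zeta> \<rho>" "norm z > 1" using z by (auto simp: V_def)
    have H_le: "norm (H k z) \<le> 2 * B * inverse (norm z) ^ k" for k
    proof -
      have "norm z ^ k * norm (H k z) \<le> norm z ^ j k * norm (H k z)"
        using z1 mnj(1) by (intro mult_right_mono power_increasing) auto
      also have "\<dots> = norm (F (m k) z - F (n k) z)"
        unfolding F_shift[OF z1(1) mnj(2)] H_def by (simp add: norm_mult norm_power)
      also have "\<dots> \<le> B + B"
        using B[OF z1(1)] z1(1) by (intro norm_triangle_le_diff add_mono) (simp_all add: F_def)
      finally have "norm (H k z) * norm z ^ k \<le> 2 * B"
        by (simp add: mult.commute)
      moreover have "norm z ^ k > 0"
        using z1 by (intro zero_less_power) linarith
      ultimately show ?thesis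
        by (simp add: power_inverse divide_inverse[symmetric] pos_le_divide_eq)
    qed
    have "inverse (norm z) < 1"
      using z1 one_less_inverse_iff[of "inverse (norm z)"] by (simp add: inverse_eq_divide)
    then have "(\<lambda>k. 2 * B * inverse (norm z) ^ k) \<longlonglongrightarrow> 0"
      by (intro tendsto_mult_right_zero LIMSEQ_realpow_zero) auto
    then have "(\<lambda>k. H k z) \<longlonglongrightarrow> 0"
      by (rule Lim_null_comparison[rotated]) (rule always_eventually, rule allI, rule H_le)
    then have "(\<lambda>k. H (r k) z) \<longlonglongrightarrow> 0"
      using LIMSEQ_subseq_LIMSEQ[OF _ \<open>strict_mono r\<close>, of "\<lambda>k. H k z" 0] by (simp add: o_def)
    then show ?thesis
      using LIMSEQ_unique[OF lim] z1 by (auto simp: \<Omega>_def)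
  qed
  have "G 0 = 0"
  proof (rule analytic_continuation_open[where s = V and s' = \<Omega> and f = G and g = "\<lambda>_. 0"])
    show "open V"
      unfolding V_def by (intro open_Int open_Collect_less continuous_intros) auto
    have norm_ray: "norm (of_real s * \<zeta>) = \<bar>s\<bar>" for s :: real
      using \<zeta> by (simp add: norm_mult)
    have dist_ray: "dist \<zeta> (of_real s * \<zeta>) = \<bar>1 - s\<bar>" for s :: real
    proof -
      have "\<zeta> - of_real s * \<zeta> = of_real (1 - s) * \<zeta>"
        by (simp add: algebra_simps)
      then show ?thesis
        unfolding dist_norm by (metis norm_ray)
    qed
    have "of_real (1 + \<rho> / 2) * \<zeta> \<in> V"
      unfolding V_def using \<rho> norm_ray[of "1 + \<rho> / 2"] dist_ray[of "1 + \<rho> / 2"] by auto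
    then show "V \<noteq> {}" by blast
    have "of_real (1 - \<rho> / 2) * \<zeta> \<in> ball \<zeta> \<rho> \<inter> ball 0 1"
      using \<rho> \<rho>1 norm_ray[of "1 - \<rho> / 2"] dist_ray[of "1 - \<rho> / 2"] by auto
    then show "connected \<Omega>"
      unfolding \<Omega>_def by (intro connected_Un) auto
  qed (use G G_out \<open>open \<Omega>\<close> in \<open>auto simp: V_def \<Omega>_def\<close>)
  \<comment> \<open>The finitely many nonzero distances between coefficients have a positive minimum.\<close>
  define E where "E = (\<lambda>(x, y). norm (x - y)) ` (range c \<times> range c) - {0}"
  have "finite E" using fin by (simp add: E_def)
  then obtain \<epsilon> where "\<epsilon> > 0" and \<epsilon>: "\<And>x. x \<in> E \<Longrightarrow> \<epsilon> \<le> x"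
  proof (cases "E = {}")
    case False
    have "Min E > 0"
      using \<open>finite E\<close> False by (auto simp: E_def)
    then show ?thesis
      using that[of "Min E"] \<open>finite E\<close> by simp
  qed (use that[of 1] in auto)
  have "norm (H k 0) \<ge> \<epsilon>" for k
  proof -
    have "H k 0 = c (m k + j k) - c (n k + j k)"
      by (simp add: H_def F_in)
    then have "norm (H k 0) \<in> E"
      using mnj(3)[of k] by (auto simp: E_def image_iff)
    then show ?thesis by (rule \<epsilon>)
  qed
  then have "norm (G 0) \<ge> \<epsilon>"
    using lim[of 0] by (intro Lim_bounded2[OF tendsto_norm[OF lim[of 0]]]) (auto simp: \<Omega>_def)
  then show False
    using \<open>G 0 = 0\<close> \<open>\<epsilon> > 0\<close> by simp
qed

section \<open>Poles on the unit circle\<close>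

lemma shifted_series_eventually_periodic:
  assumes A: "\<forall>k. norm (c k) \<le> A" and per: "\<And>n. n \<ge> N \<Longrightarrow> c (n + p) = c n"
  obtains Q where "\<And>z. norm z < 1 \<Longrightarrow> (1 - z ^ p) * shifted_series c 0 z = poly Q z"
proof
  define s where "s n m = (\<Sum>k<m. monom (c (n + k)) k)" for n m
  have poly_s: "poly (s n m) z = (\<Sum>k<m. c (n + k) * z ^ k)" for n m z
    by (simp add: s_def poly_sum poly_monom)
  fix z :: complex assume z: "norm z < 1"
  have "shifted_series c (N + p) z = shifted_series c N z"
    unfolding shifted_series_def using per[of "N + k" for k] by (simp add: add.assoc add.left_commute add.commute)
  moreover have "shifted_series c N z = poly (s N p) z + z ^ p * shifted_series c (N + p) z"
    using shifted_series_split[of "\<lambda>k. c (N + k)" A z p] A z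
    by (simp add: poly_s shifted_series_def add.assoc)
  ultimately have block: "poly (s N p) z = shifted_series c N z - z ^ p * shifted_series c N z"
    unfolding eq_diff_eq by simp
  have "shifted_series c 0 z = poly (s 0 N) z + z ^ N * shifted_series c N z"
    using shifted_series_split[OF A z, of N] by (simp add: poly_s)
  then have "(1 - z ^ p) * shifted_series c 0 z = (1 - z ^ p) * poly (s 0 N) z + z ^ N * poly (s N p) z"
    unfolding block by (simp add: algebra_simps)
  then show "(1 - z ^ p) * shifted_series c 0 z
      = poly ((1 - monom 1 p) * s 0 N + monom 1 N * s N p) z"
    by (simp add: poly_monom)
qed

text \<open>The equation says that the logarithmic derivative of \<open>\<Phi>\<close> is \<open>E / A\<^sup>2\<close>, which has a pole of order at least 2 at
  \<open>\<omega>\<close> unless \<open>E\<close> vanishes there. But the logarithmic derivative of a holomorphic function has at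
  most a simple pole. In the proof, \<open>\<Phi>\<close> is written as \<open>(w - \<omega>) ^ n * g w\<close> with \<open>g\<close> free of zeros, the
  equation is divided by \<open>(w - \<omega>) ^ n\<close>, and \<open>w\<close> tends to \<open>\<omega>\<close>.\<close>

lemma double_pole_of_log_derivative_cancels:
  assumes hol: "\<Phi> holomorphic_on S" "A holomorphic_on S" "E holomorphic_on S"
    and S: "open S" "connected S" "\<omega> \<in> S" and nz: "w \<in> S" "\<Phi> w \<noteq> 0"
    and A: "A \<omega> = 0" and ode: "\<And>s. s \<in> S \<Longrightarrow> deriv \<Phi> s * (A s)\<^sup>2 = \<Phi> s * E s"
  shows "E \<omega> = 0"
proof (cases "\<Phi> \<omega> = 0")
  case False
  then show ?thesis using ode[OF S(3)] A by simp
next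
  case True
  then have "\<not> \<Phi> constant_on S"
    using nz S(3) unfolding constant_on_def by metis
  then obtain g r n where n: "0 < n" and r: "0 < r" and sub: "ball \<omega> r \<subseteq> S"
    and g: "g holomorphic_on ball \<omega> r"
    and \<Phi>: "\<And>w. w \<in> ball \<omega> r \<Longrightarrow> \<Phi> w = (w - \<omega>) ^ n * g w"
    and g0: "\<And>w. w \<in> ball \<omega> r \<Longrightarrow> g w \<noteq> 0"
    using holomorphic_factor_zero_nonconstant[OF hol(1) S True] by metis
  have \<omega>: "\<omega> \<in> ball \<omega> r" using r by simp
  have eq: "of_nat n * (g w * (A w * ((A w - A \<omega>) / (w - \<omega>)))) + deriv g w * (A w)\<^sup>2 = g w * E w"
    if w: "w \<in> ball \<omega> r" "w \<noteq> \<omega>" for w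
  proof -
    have "(g has_field_derivative deriv g w) (at w)"
      using g w by (intro holomorphic_derivI) auto
    then have "((\<lambda>w. (w - \<omega>) ^ n * g w) has_field_derivative
        of_nat n * (w - \<omega>) ^ (n - 1) * g w + (w - \<omega>) ^ n * deriv g w) (at w)"
      by (auto intro!: derivative_eq_intros)
    then have "(\<Phi> has_field_derivative
        of_nat n * (w - \<omega>) ^ (n - 1) * g w + (w - \<omega>) ^ n * deriv g w) (at w)"
      by (rule has_field_derivative_transform_within_open[where S = "ball \<omega> r"]) (use w \<Phi> in auto)
    then have "deriv \<Phi> w = of_nat n * (w - \<omega>) ^ (n - 1) * g w + (w - \<omega>) ^ n * deriv g w"
      by (rule DERIV_imp_deriv)
    moreover define u where "u = (w - \<omega>) ^ (n - 1)"
    moreover have pow: "(w - \<omega>) ^ n = u * (w - \<omega>)"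
      unfolding u_def using n by (cases n) auto
    ultimately have "deriv \<Phi> w = u * (of_nat n * g w + (w - \<omega>) * deriv g w)"
      by (simp add: distrib_left mult.assoc mult.left_commute)
    moreover have "\<Phi> w = u * ((w - \<omega>) * g w)"
      using \<Phi>[OF w(1)] pow by (simp add: mult.assoc)
    ultimately have "u * ((of_nat n * g w + (w - \<omega>) * deriv g w) * (A w)\<^sup>2) = u * ((w - \<omega>) * (g w * E w))"
      using ode[of w] sub w(1) by (simp only: mult.assoc) blast
    moreover have "u \<noteq> 0"
      using w(2) by (simp add: u_def)
    ultimately have "(of_nat n * g w + (w - \<omega>) * deriv g w) * (A w)\<^sup>2 = (w - \<omega>) * (g w * E w)"
      by simp
    then show ?thesis
      using w(2) A by (simp add: field_simps power2_eq_square)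
  qed
  have lim: "(h \<longlongrightarrow> h \<omega>) (at \<omega>)" if "h holomorphic_on ball \<omega> r" for h
    using holomorphic_on_imp_continuous_on[OF that] \<omega>
    by (simp add: continuous_on_eq_continuous_at isContD)
  have hA: "A holomorphic_on ball \<omega> r" and hE: "E holomorphic_on ball \<omega> r"
    using hol sub holomorphic_on_subset by blast+
  have "(A has_field_derivative deriv A \<omega>) (at \<omega>)"
    using hA \<omega> by (intro holomorphic_derivI) auto
  then have dA: "((\<lambda>w. (A w - A \<omega>) / (w - \<omega>)) \<longlongrightarrow> deriv A \<omega>) (at \<omega>)"
    by (simp add: has_field_derivative_iff)
  have "((\<lambda>w. of_nat n * (g w * (A w * ((A w - A \<omega>) / (w - \<omega>)))) + deriv g w * (A w)\<^sup>2) \<longlongrightarrow>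
      of_nat n * (g \<omega> * (A \<omega> * deriv A \<omega>)) + deriv g \<omega> * (A \<omega>)\<^sup>2) (at \<omega>)"
    by (intro tendsto_intros lim g hA dA holomorphic_deriv) auto
  moreover have "((\<lambda>w. of_nat n * (g w * (A w * ((A w - A \<omega>) / (w - \<omega>)))) + deriv g w * (A w)\<^sup>2) \<longlongrightarrow>
      g \<omega> * E \<omega>) (at \<omega>)"
  proof (rule Lim_transform_eventually)
    show "((\<lambda>w. g w * E w) \<longlongrightarrow> g \<omega> * E \<omega>) (at \<omega>)"
      by (intro tendsto_intros lim g hE)
    show "\<forall>\<^sub>F w in at \<omega>. g w * E w = of_nat n * (g w * (A w * ((A w - A \<omega>) / (w - \<omega>)))) + deriv g w * (A w)\<^sup>2"
      using eventually_at_in_open[OF open_ball \<omega>] eq by (auto elim!: eventually_mono)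
  qed
  ultimately have "g \<omega> * E \<omega> = of_nat n * (g \<omega> * (A \<omega> * deriv A \<omega>)) + deriv g \<omega> * (A \<omega>)\<^sup>2"
    using LIM_unique by blast
  then show ?thesis
    using A g0[OF \<omega>] by simp
qed

text \<open>The polynomial \<open>z ^ p - 1\<close> has only simple roots, so it is the product of its linear factors.\<close>

lemma unity_poly_dvd:
  fixes R :: "complex poly"
  assumes "p > 0" and "\<And>w. w ^ p = 1 \<Longrightarrow> poly R w = 0"
  shows "monom 1 p - 1 dvd R"
proof -
  have roots_dvd: "finite T \<Longrightarrow> (\<And>w. w \<in> T \<Longrightarrow> poly R w = 0) \<Longrightarrow> (\<Prod>w\<in>T. [:-w, 1:]) dvd R" for T
  proof (induction T rule: finite_induct)
    case (insert a T)
    then obtain U where U: "R = (\<Prod>w\<in>T. [:-w, 1:]) * U"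
      by (auto elim: dvdE)
    have "poly (\<Prod>w\<in>T. [:-w, 1:]) a \<noteq> 0"
      using insert.hyps by (auto simp: poly_prod)
    moreover have "poly R a = 0"
      using insert.prems by simp
    ultimately have "[:-a, 1:] dvd U"
      by (simp add: U poly_eq_0_iff_dvd[symmetric])
    then have "[:-a, 1:] * (\<Prod>w\<in>T. [:-w, 1:]) dvd U * (\<Prod>w\<in>T. [:-w, 1:])"
      by (rule mult_dvd_mono) simp
    also have "\<dots> = R"
      by (simp add: U mult.commute)
    finally show ?case
      unfolding prod.insert[OF insert.hyps] .
  qed simp
  have "monom 1 p - 1 = (\<Prod>w | w ^ p = 1. [:-w, 1:] :: complex poly)"
  proof -
    define A where "A = monom 1 p - (1 :: complex poly)"
    have roots: "poly A z = 0 \<longleftrightarrow> z ^ p = 1" for z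
      by (simp add: A_def poly_monom)
    have "rsquarefree A"
      unfolding rsquarefree_roots roots using assms(1)
      by (auto simp: A_def pderiv_diff pderiv_monom poly_monom power_0_left)
    moreover have "lead_coeff A = 1"
    proof -
      have "degree A = p"
        unfolding A_def using assms(1) degree_add_eq_left[of "-1" "monom (1::complex) p"]
        by (simp add: degree_monom_eq)
      then show ?thesis
        using assms(1) by (simp add: A_def)
    qed
    ultimately have "(\<Prod>w | poly A w = 0. [:-w, 1:]) = A"
      using complex_poly_decompose_rsquarefree[of A] by simp
    then show ?thesis
      unfolding roots unfolding A_def by (rule sym)
  qed
  moreover have "finite {w :: complex. w ^ p = 1}"
    using finite_roots_unity[of p] assms(1) by simp
  then have "(\<Prod>w | w ^ p = 1. [:-w, 1:]) dvd R"
    by (rule roots_dvd) (simp add: assms(2))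
  ultimately show ?thesis
    by simp
qed

text \<open>The boundary behaviour is controlled from the side of the exponential: \<open>\<Phi>\<close> is holomorphic at all points
  of the unit circle except 1 and -1. At a point where it does not vanish its logarithm continues
  \<open>K\<close>, so Szego's theorem makes \<open>K\<close> rational with denominator \<open>1 - z ^ p\<close>; at the roots of
  unity other than 1 and -1 the numerator has to vanish, since \<open>exp \<circ> K\<close> cannot have an essential
  singularity where \<open>\<Phi>\<close> is holomorphic. What remains of the denominator divides \<open>1 - z\<^sup>2\<close>.\<close>

theorem finite_coefficients_log_of_strip_function:
  assumes fin: "finite (range c)"
    and \<Phi>: "\<Phi> holomorphic_on {s. \<bar>Re s\<bar> < 1}"
    and exp_eq: "\<And>s. norm s < 1 \<Longrightarrow> exp (shifted_series c 0 s) = \<Phi> s"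
  obtains P where "\<And>s. norm s < 1 \<Longrightarrow> (1 - s\<^sup>2) * shifted_series c 0 s = poly P s"
proof -
  define K where "K = shifted_series c 0"
  define S where "S = {s. \<bar>Re s\<bar> < 1}"
  have S: "open S" "connected S"
  proof -
    have "S = {s. Re s < 1} \<inter> {s. Re s > -1}" by (auto simp: S_def)
    then have "convex S"
      using convex_halfspace_Re_lt convex_halfspace_Re_gt by (simp add: convex_Int)
    then show "connected S" by (rule convex_connected)
    show "open S"
      unfolding S_def by (intro open_Collect_less continuous_intros)
  qed
  have ball_S: "ball 0 1 \<subseteq> S"
    using abs_Re_le_cmod le_less_trans by (fastforce simp: S_def)
  have \<Phi>S: "\<Phi> holomorphic_on S" using \<Phi> by (simp add: S_def)
  obtain A where A: "\<forall>k. norm (c k) \<le> A"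
    using finite_imp_bounded[OF fin] unfolding bounded_iff by auto
  have K_hol: "K holomorphic_on ball 0 1"
    unfolding K_def by (rule holomorphic_shifted_series[OF A])
  have \<Phi>_nz: "\<Phi> s \<noteq> 0" if "norm s < 1" for s
    using exp_eq[OF that] by (metis exp_not_eq_zero)
  have K_deriv: "(K has_field_derivative deriv K s) (at s)" if "norm s < 1" for s
    using K_hol that by (intro holomorphic_derivI[where S = "ball 0 1"]) auto
  have log_deriv: "deriv \<Phi> s = deriv K s * \<Phi> s" if s: "norm s < 1" for s
  proof -
    have "((\<lambda>s. exp (K s)) has_field_derivative exp (K s) * deriv K s) (at s)"
      using K_deriv[OF s] by (auto intro!: derivative_eq_intros)
    then have "(\<Phi> has_field_derivative exp (K s) * deriv K s) (at s)"
      by (rule has_field_derivative_transform_within_open[where S = "ball 0 1"])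
         (use s exp_eq in \<open>auto simp: K_def\<close>)
    then show ?thesis
      using exp_eq[OF s] by (simp add: K_def DERIV_imp_deriv)
  qed
  have circle: "z \<in> S" if "norm z = 1" "z \<noteq> 1" "z \<noteq> -1" for z
  proof -
    have "Im z \<noteq> 0"
    proof
      assume "Im z = 0"
      then have "\<bar>Re z\<bar> = 1"
        using that(1) by (simp add: cmod_def)
      then show False
        using \<open>Im z = 0\<close> that by (auto simp: complex_eq_iff abs_if split: if_splits)
    qed
    then have "(Im z)\<^sup>2 > 0"
      by simp
    moreover have "(Re z)\<^sup>2 + (Im z)\<^sup>2 = 1"
      using that(1) cmod_power2[of z] by simp
    ultimately have "(Re z)\<^sup>2 < 1"
      by linarith
    then show ?thesis
      by (simp add: S_def abs_square_less_1)
  qed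
  obtain \<zeta> where \<zeta>: "norm \<zeta> = 1" "\<zeta> \<in> S" "\<Phi> \<zeta> \<noteq> 0"
  proof (rule ccontr)
    assume "\<not> thesis"
    then have zero: "\<Phi> z = 0" if "z \<in> sphere 0 1 - {1, -1}" for z
      using that circle[of z] \<open>\<And>\<zeta>. \<lbrakk>norm \<zeta> = 1; \<zeta> \<in> S; \<Phi> \<zeta> \<noteq> 0\<rbrakk> \<Longrightarrow> thesis\<close> by auto
    \<comment> \<open>Otherwise \<open>\<Phi>\<close> would vanish identically, as the zeros on the circle accumulate at \<open>\<i>\<close>.\<close>
    define V where "V = sphere (0 :: complex) 1 - {1, -1}"
    have sphere: "sphere 0 1 = {1, -1} \<union> V"
      by (auto simp: V_def)
    have "\<i> islimpt sphere (0 :: complex) 1"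
    proof (rule connected_imp_perfect)
      show "connected (sphere (0 :: complex) 1)"
        by (rule connected_sphere) simp
      show "sphere 0 1 \<noteq> {x}" for x :: complex
      proof
        assume eq: "sphere 0 1 = {x}"
        have "1 \<in> sphere (0 :: complex) 1" "-1 \<in> sphere (0 :: complex) 1"
          by auto
        then have "1 = x" "-1 = x"
          unfolding eq by simp_all
        then show False by simp
      qed
    qed simp
    then have lim: "\<i> islimpt V"
      unfolding sphere by (simp only: islimpt_Un_finite finite.intros)
    have "\<Phi> 0 = 0"
    proof (rule analytic_continuation[OF \<Phi>S S _ _ lim])
      show "V \<subseteq> S"
        unfolding V_def using circle by (metis DiffE insertCI mem_sphere_0 subsetI)
    qed (use zero in \<open>auto simp: S_def V_def\<close>)
    then show False using \<Phi>_nz[of 0] by simp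
  qed
  define T where "T = S \<inter> \<Phi> -` (- {0})"
  have "open T"
    unfolding T_def using holomorphic_on_imp_continuous_on[OF \<Phi>S] S(1)
    by (intro continuous_open_preimage) auto
  moreover have "\<zeta> \<in> T" using \<zeta> by (simp add: T_def)
  ultimately obtain R where R: "R > 0" "ball \<zeta> R \<subseteq> T"
    unfolding open_contains_ball by blast
  have "\<Phi> holomorphic_on ball \<zeta> R"
    using R(2) by (intro holomorphic_on_subset[OF \<Phi>S]) (auto simp: T_def)
  then have "(\<lambda>s. deriv \<Phi> s / \<Phi> s) holomorphic_on ball \<zeta> R"
    using R(2) by (intro holomorphic_on_divide holomorphic_deriv open_ball) (auto simp: T_def)
  then have "\<exists>L. \<forall>x\<in>ball \<zeta> R. (L has_field_derivative deriv \<Phi> x / \<Phi> x) (at x within ball \<zeta> R)"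
    by (rule holomorphic_convex_primitive'[OF convex_ball open_ball]) blast
  then obtain L\<^sub>0 where "\<forall>x\<in>ball \<zeta> R. (L\<^sub>0 has_field_derivative deriv \<Phi> x / \<Phi> x) (at x within ball \<zeta> R)"
    by blast
  then have L\<^sub>0: "(L\<^sub>0 has_field_derivative deriv \<Phi> x / \<Phi> x) (at x)" if "x \<in> ball \<zeta> R" for x
    using that by (simp add: at_within_open[OF _ open_ball])
  \<comment> \<open>\<open>K\<close> and the primitive of the logarithmic derivative differ by a constant, which adjusts the branch.\<close>
  have "\<exists>C. \<forall>z\<in>ball \<zeta> R \<inter> ball 0 1. K z - L\<^sub>0 z = C"
  proof (rule has_field_derivative_zero_constant)
    fix z assume z: "z \<in> ball \<zeta> R \<inter> ball 0 1"
    then have "((\<lambda>z. K z - L\<^sub>0 z) has_field_derivative deriv K z - deriv \<Phi> z / \<Phi> z) (at z)"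
      by (intro DERIV_diff K_deriv L\<^sub>0) auto
    then show "((\<lambda>z. K z - L\<^sub>0 z) has_field_derivative 0) (at z within ball \<zeta> R \<inter> ball 0 1)"
      using z log_deriv[of z] \<Phi>_nz[of z] by (auto intro: has_field_derivative_at_within)
  qed (simp add: convex_Int)
  then obtain C where C: "\<And>z. z \<in> ball \<zeta> R \<inter> ball 0 1 \<Longrightarrow> K z - L\<^sub>0 z = C"
    by blast
  have "\<exists>N p. p > 0 \<and> (\<forall>n\<ge>N. c (n + p) = c n)"
  proof (rule Szego_finite_coefficients[OF fin \<zeta>(1) R(1), where L = "\<lambda>z. L\<^sub>0 z + C"])
    show "(\<lambda>z. L\<^sub>0 z + C) holomorphic_on ball \<zeta> R"
    proof (rule holomorphic_on_add)
      show "L\<^sub>0 holomorphic_on ball \<zeta> R"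
        unfolding holomorphic_on_open[OF open_ball] using L\<^sub>0 by blast
    qed (rule holomorphic_on_const)
    show "L\<^sub>0 z + C = shifted_series c 0 z" if "z \<in> ball \<zeta> R" "norm z < 1" for z
      using C[of z] that by (auto simp: K_def)
  qed
  then obtain N p where p: "p > 0" "\<And>n. n \<ge> N \<Longrightarrow> c (n + p) = c n"
    by blast
  obtain Q where Q: "\<And>z. norm z < 1 \<Longrightarrow> (1 - z ^ p) * K z = poly Q z"
    unfolding K_def using shifted_series_eventually_periodic[OF A p(2)] by blast
  define B where "B = 1 - monom (1 :: complex) p"
  have poly_B: "poly B z = 1 - z ^ p" for z
    by (simp add: B_def poly_monom)
  \<comment> \<open>The equation \<open>deriv \<Phi> = deriv K * \<Phi>\<close> with \<open>K = Q / B\<close> and denominators cleared; in this form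
    it continues from the disk to the strip.\<close>
  have ode: "deriv \<Phi> s * (poly B s)\<^sup>2 = \<Phi> s * poly (pderiv Q * B - pderiv B * Q) s" if "s \<in> S" for s
  proof (rule analytic_continuation_open[where f = "\<lambda>s. deriv \<Phi> s * (poly B s)\<^sup>2"
        and g = "\<lambda>s. \<Phi> s * poly (pderiv Q * B - pderiv B * Q) s", OF _ S(1) _ S(2) ball_S])
    fix z :: complex assume "z \<in> ball 0 1"
    then have z: "norm z < 1" by simp
    have "((\<lambda>z. poly B z * K z) has_field_derivative poly (pderiv B) z * K z + deriv K z * poly B z) (at z)"
      using DERIV_mult[OF poly_DERIV K_deriv[OF z]] .
    then have "((\<lambda>z. poly Q z) has_field_derivative poly (pderiv B) z * K z + deriv K z * poly B z) (at z)"
      by (rule has_field_derivative_transform_within_open[where S = "ball 0 1"])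
         (use z Q in \<open>auto simp: poly_B\<close>)
    then have "poly (pderiv Q) z = poly (pderiv B) z * K z + deriv K z * poly B z"
      using DERIV_unique[OF poly_DERIV] by blast
    moreover have "poly Q z = poly B z * K z"
      using Q[OF z] by (simp add: poly_B)
    ultimately have "poly (pderiv Q * B - pderiv B * Q) z = deriv K z * (poly B z)\<^sup>2"
      by (simp add: algebra_simps power2_eq_square)
    then show "deriv \<Phi> z * (poly B z)\<^sup>2 = \<Phi> z * poly (pderiv Q * B - pderiv B * Q) z"
      by (simp add: log_deriv[OF z])
  next
    show "(\<lambda>s. deriv \<Phi> s * (poly B s)\<^sup>2) holomorphic_on S"
      by (intro holomorphic_on_mult holomorphic_on_power poly_holomorphic_on holomorphic_on_ident
          holomorphic_deriv \<Phi>S S(1))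
    show "(\<lambda>s. \<Phi> s * poly (pderiv Q * B - pderiv B * Q) s) holomorphic_on S"
      by (intro holomorphic_on_mult poly_holomorphic_on holomorphic_on_ident \<Phi>S)
  qed (use that in auto)
  have "poly ((1 - monom 1 2) * Q) w = 0" if w: "w ^ p = 1" for w
  proof (cases "w = 1 \<or> w = -1")
    case True
    then show ?thesis by (auto simp: poly_monom)
  next
    case False
    have "norm w = 1"
      using power_eq_1_iff[OF w] p(1) by simp
    then have "w \<in> S" using circle False by blast
    have "poly (pderiv Q * B - pderiv B * Q) w = 0"
    proof (rule double_pole_of_log_derivative_cancels[where A = "poly B" and \<Phi> = \<Phi> and S = S and w = 0
          and E = "poly (pderiv Q * B - pderiv B * Q)"])
      show "\<Phi> 0 \<noteq> 0" using \<Phi>_nz[of 0] by simp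
      show "0 \<in> S" by (simp add: S_def)
      show "poly B holomorphic_on S" "poly (pderiv Q * B - pderiv B * Q) holomorphic_on S"
        by (rule poly_holomorphic_on[OF holomorphic_on_ident])+
    qed (use S \<open>w \<in> S\<close> w ode \<Phi>S in \<open>simp_all add: poly_B del: poly_mult poly_diff\<close>)
    moreover have "poly (pderiv B) w \<noteq> 0"
      using p(1) w by (auto simp: B_def pderiv_diff pderiv_monom poly_monom power_0_left)
    ultimately show ?thesis
      using w by (simp add: poly_B)
  qed
  then have "monom 1 p - 1 dvd (1 - monom 1 2) * Q"
    by (intro unity_poly_dvd p(1))
  then obtain P where P: "(1 - monom 1 2) * Q = (monom 1 p - 1) * P" ..
  show ?thesis
  proof (rule that[of "- P"])
    fix s :: complex assume s: "norm s < 1"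
    have "s ^ p \<noteq> 1"
      using power_eq_1_iff[of s p] s p(1) by auto
    have "(1 - s ^ p) * ((1 - s\<^sup>2) * K s) = poly ((1 - monom 1 2) * Q) s"
      using Q[OF s] by (simp add: poly_monom ac_simps)
    also have "\<dots> = (1 - s ^ p) * poly (- P) s"
      unfolding P by (simp add: poly_monom algebra_simps)
    finally have "(1 - s ^ p) * ((1 - s\<^sup>2) * K s) = (1 - s ^ p) * poly (- P) s" .
    moreover have "1 - s ^ p \<noteq> 0"
      using \<open>s ^ p \<noteq> 1\<close> by simp
    ultimately show "(1 - s\<^sup>2) * shifted_series c 0 s = poly (- P) s"
      unfolding K_def using mult_left_cancel by blast
  qed
qed

section \<open>Characteristic functions with finitely many different normalized cumulants\<close>

theorem theorem3p1:
  fixes M :: "'a measure" and X :: "'a \<Rightarrow> real" and f :: "real \<Rightarrow> complex"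
    and r :: real and g :: "complex \<Rightarrow> complex" and D :: "complex set"
  assumes "prob_space M"
    and "X \<in> borel_measurable M"
    and "\<not> (\<exists>c. AE \<omega> in M. X \<omega> = c)"
    and "f = char (distr M borel X)"
    and "r > 0"
    and "analytic_in_disk f r"
    and "is_log_of g f D"
    and "finite {cumulant g k / fact k | k. True}"
  shows "(\<exists>\<sigma> a :: real. \<sigma> \<ge> 0 \<and>
            (\<forall>t\<in>D. g t = - (of_real \<sigma>)\<^sup>2 * t\<^sup>2 + \<i> * of_real a * t)) \<or>
         (\<exists>P :: complex poly.
            (\<forall>t\<in>D. 1 + \<i> * t \<noteq> 0 \<longrightarrow> g t = poly P t / (1 + \<i> * t)) \<or>
            (\<forall>t\<in>D. 1 - \<i> * t \<noteq> 0 \<longrightarrow> g t = poly P t / (1 - \<i> * t))) \<or>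
         (\<exists>P :: complex poly.
            \<forall>t\<in>D. 1 + t\<^sup>2 \<noteq> 0 \<longrightarrow> g t = poly P t / (1 + t\<^sup>2))"
proof -
  define \<mu> where "\<mu> = distr M borel X"
  interpret prob_space M by fact
  interpret \<mu>: real_distribution \<mu>
    unfolding \<mu>_def using assms(2) by (rule real_distribution_distr)
  have f: "f t = char \<mu> t" for t
    by (simp add: assms(4) \<mu>_def)
  have D: "open D" "connected D" "0 \<in> D" "g analytic_on D" "\<forall>\<^sub>F t in nhds 0. exp (g (of_real t)) = f t"
    using assms(7) by (auto simp: is_log_of_def)
  define c where "c k = cumulant g k / fact k" for k
  have fin: "finite (range c)"
    using assms(8) by (simp add: c_def full_SetCompr_eq)
  then obtain A where A: "\<forall>k. norm (c k) \<le> A"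
    using finite_imp_bounded[OF fin] unfolding bounded_iff by auto
  define K where "K = shifted_series c 0"
  have K_hol: "K holomorphic_on ball 0 1"
    unfolding K_def by (rule holomorphic_shifted_series[OF A])
  have "g analytic_on {0}"
    using D analytic_on_subset by blast
  then have "\<forall>\<^sub>F t in nhds 0. (\<lambda>k. \<i> ^ k * (cumulant g k / fact k) * t ^ k) sums g t"
    by (rule sums_cumulant)
  then have "\<forall>\<^sub>F t in nhds 0. g t = K (\<i> * t)"
    by (rule eventually_mono)
       (auto simp: K_def shifted_series_def c_def sums_iff power_mult_distrib mult.commute mult.left_commute)
  then obtain e where "e > 0" and e: "\<And>t. norm t < e \<Longrightarrow> g t = K (\<i> * t)"
    unfolding eventually_nhds_metric by (auto simp: dist_norm)
  obtain d where "d > 0" and d: "\<And>t. \<bar>t\<bar> < d \<Longrightarrow> exp (g (of_real t)) = f t"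
    using D(5) unfolding eventually_nhds_metric by (auto simp: dist_norm)
  define H where "H t = exp (K (\<i> * t))" for t
  have H_hol: "H holomorphic_on ball 0 1"
    unfolding H_def by (intro holomorphic_intros holomorphic_on_compose_gen[OF _ K_hol, unfolded o_def])
      (auto simp: norm_mult)
  have H_char: "H (of_real t) = char \<mu> t" if "\<bar>t\<bar> < min d e" for t
    using that d[of t] e[of "of_real t"] f by (simp add: H_def)
  then have "\<forall>\<^sub>F t in nhds 0. H (of_real t) = char \<mu> t"
    unfolding eventually_nhds_metric using \<open>d > 0\<close> \<open>e > 0\<close>
    by (intro exI[of _ "min d e"]) (auto simp: dist_norm)
  then have exp_int: "integrable \<mu> (\<lambda>x. exp (y * \<bar>x\<bar>))" if "\<bar>y\<bar> < 1" for y
    using \<mu>.integrable_exp_abs_if_char_analytic[OF _ H_hol] that by simp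
  define \<Phi> where "\<Phi> s = (CLINT x|\<mu>. exp (s * of_real x))" for s
  have \<Phi>_hol: "\<Phi> holomorphic_on {s. \<bar>Re s\<bar> < 1}"
    unfolding \<Phi>_def by (rule \<mu>.holomorphic_moment_generating_function[OF exp_int])
  have \<Phi>_char: "\<Phi> (\<i> * of_real t) = char \<mu> t" for t
    by (simp add: \<Phi>_def char_def mult.assoc)
  \<comment> \<open>Both sides are known to agree on a segment of the imaginary axis, where they are
    the characteristic function.\<close>
  have exp_K: "exp (K s) = \<Phi> s" if s: "norm s < 1" for s
  proof -
    define U where "U = complex_of_real ` {-min d e<..<min d e}"
    have "H (- \<i> * s) - \<Phi> (\<i> * (- \<i> * s)) = 0"
    proof (rule analytic_continuation[of "\<lambda>t. H t - \<Phi> (\<i> * t)" "ball 0 1" "U \<inter> ball 0 1" 0])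
      have "\<bar>Re (\<i> * t)\<bar> < 1" if "norm t < 1" for t
        using abs_Im_le_cmod[of t] that by simp
      then show "(\<lambda>t. H t - \<Phi> (\<i> * t)) holomorphic_on ball 0 1"
        by (intro holomorphic_intros H_hol holomorphic_on_compose_gen[OF _ \<Phi>_hol, unfolded o_def]) auto
      show "0 islimpt U \<inter> ball 0 1"
        unfolding islimpt_approachable
      proof (intro allI impI)
        fix r :: real assume "r > 0"
        define t where "t = min (min d e) (min r 1) / 2"
        have "0 < t" "t < d" "t < e" "t < r" "t < 1"
          using \<open>r > 0\<close> \<open>d > 0\<close> \<open>e > 0\<close> by (auto simp: t_def)
        then show "\<exists>x'\<in>U \<inter> ball 0 1. x' \<noteq> 0 \<and> dist x' 0 < r"
          by (intro bexI[of _ "of_real t"]) (auto simp: U_def)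
      qed
      show "H z - \<Phi> (\<i> * z) = 0" if "z \<in> U \<inter> ball 0 1" for z
      proof -
        obtain x where "z = of_real x" "- min d e < x" "x < min d e"
          using \<open>z \<in> U \<inter> ball 0 1\<close> unfolding U_def by auto
        moreover from this have "\<bar>x\<bar> < min d e"
          unfolding abs_less_iff by linarith
        ultimately have "H z = char \<mu> x"
          using H_char by blast
        then show ?thesis
          using \<open>z = of_real x\<close> \<Phi>_char[of x] by simp
      qed
    qed (use s in \<open>auto simp: norm_mult\<close>)
    then show ?thesis
      by (simp add: H_def flip: mult.assoc)
  qed
  obtain P where P: "\<And>s. norm s < 1 \<Longrightarrow> (1 - s\<^sup>2) * K s = poly P s"
    using finite_coefficients_log_of_strip_function[OF fin \<Phi>_hol] exp_K unfolding K_def by blast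
  \<comment> \<open>The substitution \<open>s = \<i> * t\<close> turns \<open>1 - s\<^sup>2\<close> into \<open>1 + t\<^sup>2\<close>.\<close>
  define Q where "Q = pcompose P [:0, \<i>:]"
  have "g t * (1 + t\<^sup>2) = poly Q t" if "t \<in> D" for t
  proof (rule analytic_continuation_open[of "D \<inter> ball 0 (min e 1)" D
        "\<lambda>t. g t * (1 + t\<^sup>2)" "poly Q"])
    show "D \<inter> ball 0 (min e 1) \<noteq> {}"
      using D(3) \<open>e > 0\<close> by auto
    show "(\<lambda>t. g t * (1 + t\<^sup>2)) holomorphic_on D"
      using D(4) by (intro holomorphic_intros analytic_imp_holomorphic)
    show "g z * (1 + z\<^sup>2) = poly Q z" if "z \<in> D \<inter> ball 0 (min e 1)" for z
      using that e[of z] P[of "\<i> * z"]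
      by (simp add: Q_def poly_pcompose norm_mult power_mult_distrib mult.commute)
  qed (use D that in \<open>auto intro!: holomorphic_intros\<close>)
  then have "\<forall>t\<in>D. 1 + t\<^sup>2 \<noteq> 0 \<longrightarrow> g t = poly Q t / (1 + t\<^sup>2)"
    by (auto simp: field_simps)
  then show ?thesis
    by blast
qed

end
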